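(* Let $\Bbbk$ be a field of characteristic zero with algebraic closure $\overline{\Bbbk}$, and let $K=K\{p(x)xy\}$ for some polynomial $p\in\Bbbk[x]$. Then $K$ has the Dixmier property if and only if $\deg p\ge2$ and $p$ has a nonzero root in $\overline{\Bbbk}$.
   Context: For $\mathbf f\in\Bbbk(x,y)$, $K\{\mathbf f\}$ denotes the rational function field $\Bbbk(x,y)$ equipped with the unique ($\Bbbk$-bilinear) Poisson bracket such that $\{x,y\}=\mathbf f$; explicitly $\{g,h\}=\left(\frac{\partial g}{\partial x}\frac{\partial h}{\partial y}-\frac{\partial g}{\partial y}\frac{\partial h}{\partial x}\right)\mathbf f$. A Poisson field $K$ has the Dixmier property if every Poisson endomorphism of $K$ (a $\Bbbk$-algebra endomorphism preserving the Poisson bracket) is an automorphism. The zero polynomial is regarded as having degree less than $0$. *)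

theory Defs
  imports
    "HOL-Computational_Algebra.Polynomial_Factorial"
    "HOL-Algebra.Algebraic_Closure_Type"
begin

text \<open>
  The rational function field in \<open>x, y\<close> over \<open>'k\<close> is the fraction field of \<open>'k[x][y]\<close>:
  the inner polynomial variable is \<open>x\<close>, the outer one is \<open>y\<close>.
\<close>
type_synonym 'k ratfun2 = "'k poly poly fract"

definition rf_const :: "'k::field \<Rightarrow> 'k ratfun2" where
  "rf_const c = to_fract [:[:c:]:]"

definition rf_X :: "'k::field ratfun2" where
  "rf_X = to_fract [:[:0, 1:]:]"

definition rf_Y :: "'k::field ratfun2" where
  "rf_Y = to_fract [:0, 1:]"

definition rf_poly_x :: "'k::field poly \<Rightarrow> 'k ratfun2" where
  "rf_poly_x p = to_fract [:p:]"

lemma map_poly_pderiv_mult: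
  fixes a b :: "'k::field poly poly"
  shows "map_poly pderiv (a * b) = map_poly pderiv a * b + a * map_poly pderiv b"
proof (rule poly_eqI)
  fix n
  have pderiv_sum: "pderiv (sum f A) = (\<Sum>i\<in>A. pderiv (f i))" for f :: "nat \<Rightarrow> 'k poly" and A
    by (induction A rule: infinite_finite_induct) (simp_all add: pderiv_add)
  show "poly.coeff (map_poly pderiv (a * b)) n =
        poly.coeff (map_poly pderiv a * b + a * map_poly pderiv b) n"
    unfolding coeff_add coeff_mult coeff_map_poly[where f = pderiv, OF pderiv_0] pderiv_sum pderiv_mult sum.distrib
    by (simp add: mult.commute add.commute)
qed

lemma Fract_rep_fract:
  fixes q :: "'a::idom fract"
  shows "snd (rep_fract q) \<noteq> 0"
    and "Fraction_Field.Fract (fst (rep_fract q)) (snd (rep_fract q)) = q"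
proof -
  have "fractrel (rep_fract q) (rep_fract q)"
    using Quotient3_rep_reflp[OF Quotient3_fract] .
  thus nz: "snd (rep_fract q) \<noteq> 0" by simp
  show "Fraction_Field.Fract (fst (rep_fract q)) (snd (rep_fract q)) = q"
    using nz Quotient3_abs_rep[OF Quotient3_fract, of q]
    by (simp add: Fraction_Field.Fract_def)
qed

lemma quotient_rule_well_defined:
  fixes D :: "'a::idom \<Rightarrow> 'a"
  assumes D: "\<And>a b. D (a * b) = D a * b + a * D b"
    and nz: "b \<noteq> 0" "d \<noteq> 0"
    and eq: "Fraction_Field.Fract a b = Fraction_Field.Fract c d"
  shows "Fraction_Field.Fract (D a * b - a * D b) (b\<^sup>2) =
         Fraction_Field.Fract (D c * d - c * D d) (d\<^sup>2)"
proof -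
  from nz eq have e: "a * d = c * b" by (simp add: eq_fract)
  hence "D (a * d) = D (c * b)" by simp
  hence e': "D a * d + a * D d = D c * b + c * D b" by (simp add: D)
  have "(D a * b - a * D b) * d\<^sup>2 = (D c * d - c * D d) * b\<^sup>2"
  proof -
    have "(D a * b - a * D b) * d\<^sup>2 - (D c * d - c * D d) * b\<^sup>2 =
        b * d * (D a * d + a * D d - (D c * b + c * D b)) - (a * d - c * b) * (d * D b + b * D d)"
      by (simp add: algebra_simps power2_eq_square)
    thus ?thesis by (simp add: e e')
  qed
  thus ?thesis using nz by (simp add: eq_fract)
qed

text \<open>
  The partial derivatives, extended from polynomials to fractions by the quotient rule. The
  representative chosen by \<^const>\<open>rep_fract\<close> is irrelevant, see \<open>rf_dx_Fract\<close> and
  \<open>rf_dy_Fract\<close>.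
\<close>

definition rf_dx :: "'k::field ratfun2 \<Rightarrow> 'k ratfun2" where
  "rf_dx q = (case rep_fract q of (a, b) \<Rightarrow>
     Fraction_Field.Fract (map_poly pderiv a * b - a * map_poly pderiv b) (b\<^sup>2))"

definition rf_dy :: "'k::field ratfun2 \<Rightarrow> 'k ratfun2" where
  "rf_dy q = (case rep_fract q of (a, b) \<Rightarrow>
     Fraction_Field.Fract (pderiv a * b - a * pderiv b) (b\<^sup>2))"

lemma rf_dx_Fract:
  assumes "b \<noteq> 0"
  shows "rf_dx (Fraction_Field.Fract a b) =
     Fraction_Field.Fract (map_poly pderiv a * b - a * map_poly pderiv b) (b\<^sup>2)"
  unfolding rf_dx_def case_prod_unfold
  by (rule quotient_rule_well_defined)
     (use assms in \<open>simp_all add: map_poly_pderiv_mult Fract_rep_fract\<close>)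

lemma rf_dy_Fract:
  assumes "b \<noteq> 0"
  shows "rf_dy (Fraction_Field.Fract a b) =
     Fraction_Field.Fract (pderiv a * b - a * pderiv b) (b\<^sup>2)"
  unfolding rf_dy_def case_prod_unfold
  by (rule quotient_rule_well_defined)
     (use assms in \<open>simp_all add: pderiv_mult algebra_simps Fract_rep_fract\<close>)

lemma map_poly_pderiv_1 [simp]: "map_poly pderiv 1 = (0 :: 'k::field poly poly)"
  by (simp add: poly_eq_iff coeff_map_poly)

lemma rf_dx_to_fract: "rf_dx (to_fract a) = to_fract (map_poly pderiv a)"
  by (simp add: to_fract_def rf_dx_Fract)

lemma rf_dy_to_fract: "rf_dy (to_fract a) = to_fract (pderiv a)"
  by (simp add: to_fract_def rf_dy_Fract)

lemma rf_dx_X [simp]: "rf_dx rf_X = 1"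
  and rf_dx_Y [simp]: "rf_dx rf_Y = 0"
  and rf_dy_X [simp]: "rf_dy rf_X = 0"
  and rf_dy_Y [simp]: "rf_dy rf_Y = 1"
  by (simp_all add: rf_X_def rf_Y_def rf_dx_to_fract rf_dy_to_fract map_poly_pCons pderiv_pCons
      flip: one_pCons)

definition poisson_bracket :: "'k::field ratfun2 \<Rightarrow> 'k ratfun2 \<Rightarrow> 'k ratfun2 \<Rightarrow> 'k ratfun2" where
  "poisson_bracket f g h = (rf_dx g * rf_dy h - rf_dy g * rf_dx h) * f"

definition algebra_endomorphism :: "('k::field ratfun2 \<Rightarrow> 'k ratfun2) \<Rightarrow> bool" where
  "algebra_endomorphism \<phi> \<longleftrightarrow>
     (\<forall>g h. \<phi> (g + h) = \<phi> g + \<phi> h) \<and>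
     (\<forall>g h. \<phi> (g * h) = \<phi> g * \<phi> h) \<and>
     (\<forall>c. \<phi> (rf_const c) = rf_const c)"

definition poisson_endomorphism ::
    "'k::field ratfun2 \<Rightarrow> ('k ratfun2 \<Rightarrow> 'k ratfun2) \<Rightarrow> bool" where
  "poisson_endomorphism f \<phi> \<longleftrightarrow> algebra_endomorphism \<phi> \<and>
     (\<forall>g h. \<phi> (poisson_bracket f g h) = poisson_bracket f (\<phi> g) (\<phi> h))"

text \<open>
  Dixmier property of the rational function field with bracket determined by \<open>{x, y} = f\<close>.
  The inverse of a bijective Poisson endomorphism again preserves constants, sums, products and
  the bracket, so automorphisms are exactly the bijective endomorphisms.
\<close>
definition dixmier_property :: "'k::field ratfun2 \<Rightarrow> bool" where
  "dixmier_property f \<longleftrightarrow> (\<forall>\<phi>. poisson_endomorphism f \<phi> \<longrightarrow> bij \<phi>)"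

lemma poisson_bracket_X_Y: "poisson_bracket f rf_X rf_Y = f"
  by (simp add: poisson_bracket_def)

end

theory Submission
  imports Defs
begin

text \<open>
  Let \<open>f = x p(x)\<close>. A Poisson endomorphism is given by a pair \<open>(X, Y)\<close> with
  \<open>{X, Y} = f(X) Y\<close>, i.e. it preserves the form \<open>dx/f(x) \<and> dy/y\<close>.

  If \<open>deg f \<ge> 3\<close>, this form vanishes along \<open>x = \<infinity>\<close>, so its pullback vanishes to high order wherever
  \<open>X\<close> has a pole, while the original form has no zeros on the affine line times the projective
  line. Hence \<open>X\<close> has no poles there: it is a polynomial in \<open>x\<close>, and comparing degrees it is affine,
  \<open>X = a x + b\<close>. Then \<open>Y = g(x) y\<^sup>m\<close> and \<open>f(a x + b) = a m f(x)\<close>, so \<open>m = a ^ (deg f - 1)\<close>. If \<open>f\<close> has two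
  distinct roots, then \<open>a\<close> is a root of unity, whence the integer \<open>m\<close> is \<open>1\<close> or \<open>-1\<close> and the
  endomorphism is surjective.

  In the remaining cases there is an explicit endomorphism whose image is fixed by a nontrivial
  involution. If \<open>p\<close> is constant, or of degree \<open>1\<close> with a nonzero root, then up to a Moebius
  change of \<open>x\<close> the bracket is a multiple of \<open>{x, y} = x y\<close>, and the fixed field of
  \<open>x \<mapsto> 1/x\<close>, \<open>y \<mapsto> 1/y\<close> is isomorphic to the whole Poisson field.
\<close>

subsection \<open>Homomorphisms and derivations\<close>

locale coeff_hom =
  fixes h :: "'a::idom \<Rightarrow> 'b::idom"
  assumes hom_add: "h (a + b) = h a + h b"
    and hom_mult: "h (a * b) = h a * h b"
    and hom_1: "h 1 = 1"
begin

lemma hom_0: "h 0 = 0"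
  using hom_add[of 0 0] by (metis add.right_neutral add_left_cancel)

lemma hom_minus: "h (- a) = - h a"
  using hom_add[of a "- a"] hom_0 by (simp add: eq_neg_iff_add_eq_0 add.commute)

lemma hom_diff: "h (a - b) = h a - h b"
  using hom_add[of a "- b"] hom_minus by simp

lemma hom_of_nat: "h (of_nat n) = of_nat n"
  by (induction n) (simp_all add: hom_0 hom_1 hom_add)

lemma map_poly_hom_pCons: "map_poly h (pCons c p) = pCons (h c) (map_poly h p)"
  by (simp add: map_poly_pCons hom_0)

lemma coeff_map_poly_hom: "poly.coeff (map_poly h p) n = h (poly.coeff p n)"
  by (simp add: coeff_map_poly hom_0)

lemma map_poly_hom_add: "map_poly h (p + q) = map_poly h p + map_poly h q"
  by (rule poly_eqI) (simp add: coeff_map_poly_hom hom_add)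

lemma map_poly_hom_smult: "map_poly h (smult c p) = smult (h c) (map_poly h p)"
  by (rule poly_eqI) (simp add: coeff_map_poly_hom hom_mult)

lemma map_poly_hom_mult: "map_poly h (p * q) = map_poly h p * map_poly h q"
  by (induction p)
    (simp_all add: map_poly_hom_pCons map_poly_hom_add map_poly_hom_smult hom_0)

lemma map_poly_hom: "coeff_hom (map_poly h)"
  by standard (simp_all add: map_poly_hom_add map_poly_hom_mult one_pCons map_poly_hom_pCons hom_1)

lemma eval_hom: "coeff_hom (\<lambda>p. poly (map_poly h p) x)"
  by standard (simp_all add: map_poly_hom_add map_poly_hom_mult one_pCons map_poly_hom_pCons hom_1)

lemma map_poly_hom_pderiv: "map_poly h (pderiv p) = pderiv (map_poly h p)"
  by (rule poly_eqI) (simp add: coeff_map_poly_hom coeff_pderiv hom_mult hom_of_nat hom_1 hom_add)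

lemma inj_map_poly: "inj h \<Longrightarrow> inj (map_poly h)"
  by (intro injI poly_eqI) (metis coeff_map_poly_hom injD)

lemma hom_power: "h (a ^ n) = h a ^ n"
  by (induction n) (simp_all add: hom_1 hom_mult)

lemma hom_sum: "h (sum g S) = (\<Sum>x\<in>S. h (g x))"
  by (induction S rule: infinite_finite_induct) (simp_all add: hom_0 hom_add)

end

lemma coeff_hom_comp: "coeff_hom g \<Longrightarrow> coeff_hom h \<Longrightarrow> coeff_hom (\<lambda>x. g (h x))"
  by (simp add: coeff_hom_def)

locale derivation =
  fixes D :: "'a::idom \<Rightarrow> 'a"
  assumes add: "D (a + b) = D a + D b"
    and mult: "D (a * b) = D a * b + a * D b"
begin

lemma zero: "D 0 = 0"
  using add[of 0 0] by (metis add.right_neutral add_left_cancel)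

lemma one: "D 1 = 0"
  using mult[of 1 1] by (metis add.right_neutral add_left_cancel mult_1_left mult_1_right)

lemma minus: "D (- a) = - D a"
  using add[of a "- a"] zero by (simp add: eq_neg_iff_add_eq_0 add.commute)

lemma diff: "D (a - b) = D a - D b"
  using add[of a "- b"] minus by simp

lemma power: "D (a ^ n) = of_nat n * a ^ (n - 1) * D a"
proof (induction n)
  case (Suc n)
  then show ?case
    by (cases n) (simp_all add: mult algebra_simps)
qed (simp add: one)

lemma chain_poly:
  assumes h: "coeff_hom h" and const: "\<And>c. D (h c) = 0"
  shows "D (poly (map_poly h p) u) = poly (map_poly h (pderiv p)) u * D u"
proof -
  interpret coeff_hom h by fact
  show ?thesis
    by (induction p)
      (simp_all add: zero add mult const pderiv_pCons map_poly_hom_pCons map_poly_hom_add hom_0 algebra_simps)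
qed

text \<open>The two-variable chain rule for any derivation that kills constants;
  \<open>rf_dx\<close> and \<open>rf_dy\<close> are both instances.\<close>

lemma chain_poly_poly:
  fixes h :: "'b::field \<Rightarrow> 'a"
  assumes h: "coeff_hom h" and const: "\<And>c. D (h c) = 0"
  defines "ev \<equiv> \<lambda>P u v. poly (map_poly (\<lambda>p. poly (map_poly h p) u) P) v"
  shows "D (ev P u v) = ev (map_poly pderiv P) u v * D u + ev (pderiv P) u v * D v"
proof -
  interpret coeff_hom h by fact
  interpret e: coeff_hom "\<lambda>p. poly (map_poly h p) u" by (rule eval_hom)
  show ?thesis
    unfolding ev_def
    by (induction P)
      (simp_all add: zero add mult chain_poly[OF h const] pderiv_pCons e.map_poly_hom_pCons e.map_poly_hom_add
        map_poly_pCons e.hom_0 algebra_simps)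
qed

end

locale field_derivation = derivation D for D :: "'a::field \<Rightarrow> 'a"
begin

lemma divide:
  assumes "b \<noteq> 0"
  shows "D (a / b) = (D a * b - a * D b) / b\<^sup>2"
proof -
  have "D a = D (a / b) * b + a / b * D b"
    using mult[of "a / b" b] assms by simp
  then show ?thesis
    using assms by (simp add: field_simps power2_eq_square)
qed

end

lemma map_poly_pderiv_add: "map_poly pderiv (a + b) = map_poly pderiv a + map_poly pderiv (b :: 'k::field poly poly)"
  by (rule poly_eqI) (simp add: coeff_map_poly pderiv_add)

lemma field_derivation_quotient:
  fixes D :: "'a::idom \<Rightarrow> 'a" and E :: "'a fract \<Rightarrow> 'a fract"
  assumes add: "\<And>a b. D (a + b) = D a + D b" and mult: "\<And>a b. D (a * b) = D a * b + a * D b"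
    and E: "\<And>a b. b \<noteq> 0 \<Longrightarrow> E (Fraction_Field.Fract a b) = Fraction_Field.Fract (D a * b - a * D b) (b\<^sup>2)"
  shows "field_derivation E"
proof
  fix q r :: "'a fract"
  obtain a b c d where q: "q = Fraction_Field.Fract a b" "b \<noteq> 0" and r: "r = Fraction_Field.Fract c d" "d \<noteq> 0"
    by (metis Fract_cases)
  show "E (q + r) = E q + E r" "E (q * r) = E q * r + q * E r"
    using q r by (simp_all add: E eq_fract add mult power2_eq_square algebra_simps)
qed

interpretation dx: field_derivation rf_dx
  by (rule field_derivation_quotient[of "map_poly pderiv"])
    (simp_all add: map_poly_pderiv_add map_poly_pderiv_mult rf_dx_Fract)

interpretation dy: field_derivation rf_dy
  by (rule field_derivation_quotient[of pderiv])
    (simp_all add: pderiv_add pderiv_mult rf_dy_Fract algebra_simps)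

interpretation rf_const: coeff_hom rf_const
  by standard (simp_all add: rf_const_def flip: to_fract_add to_fract_mult one_pCons)

lemma rf_const_eq_iff [simp]: "rf_const a = rf_const b \<longleftrightarrow> a = b"
  by (simp add: rf_const_def)

lemma rf_const_eq_0_iff [simp]: "rf_const a = 0 \<longleftrightarrow> a = 0"
  by (simp add: rf_const_def)

lemma rf_dx_const [simp]: "rf_dx (rf_const c) = 0"
  and rf_dy_const [simp]: "rf_dy (rf_const c) = 0"
  by (simp_all add: rf_const_def rf_dx_to_fract rf_dy_to_fract map_poly_pCons)

section \<open>Evaluation of bivariate polynomials at pairs of rational functions\<close>

definition rf_eval where
  "rf_eval u v P = poly (map_poly (\<lambda>p. poly (map_poly rf_const p) u) P) v"

lemma rf_eval_hom: "coeff_hom (rf_eval u v)"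
  unfolding rf_eval_def
  by (intro coeff_hom.eval_hom rf_const.coeff_hom_axioms)

lemma rf_poly_x_eq: "rf_poly_x p = poly (map_poly rf_const p) rf_X"
proof (induction p)
  case (pCons a p)
  have "rf_poly_x (pCons a p) = rf_const a + rf_X * rf_poly_x p"
    by (simp add: rf_poly_x_def rf_const_def rf_X_def flip: to_fract_add to_fract_mult)
  then show ?case
    using pCons by (simp add: rf_const.map_poly_hom_pCons)
qed (simp add: rf_poly_x_def)

lemma to_fract_eq_eval: "to_fract P = rf_eval rf_X rf_Y P"
proof (induction P)
  case (pCons p P)
  interpret e: coeff_hom "\<lambda>p. poly (map_poly rf_const p) rf_X" by (rule rf_const.eval_hom)
  have "to_fract (pCons p P) = to_fract [:p:] + rf_Y * to_fract P"
    by (simp add: rf_Y_def flip: to_fract_add to_fract_mult)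
  then show ?case
    using pCons rf_poly_x_eq[of p]
    by (simp add: rf_eval_def e.map_poly_hom_pCons rf_poly_x_def)
qed (simp add: rf_eval_def)

lemma
  assumes "coeff_hom h" and const: "\<And>c. h (rf_const c) = rf_const c"
  shows hom_rf_eval_x: "h (poly (map_poly rf_const p) u) = poly (map_poly rf_const p) (h u)"
    and hom_rf_eval: "h (rf_eval u v P) = rf_eval (h u) (h v) P"
proof -
  interpret h: coeff_hom h by fact
  show *: "h (poly (map_poly rf_const p) u) = poly (map_poly rf_const p) (h u)" for p
    by (induction p) (simp_all add: h.hom_0 h.hom_add h.hom_mult const rf_const.map_poly_hom_pCons)
  show "h (rf_eval u v P) = rf_eval (h u) (h v) P"
    unfolding rf_eval_def by (induction P) (simp_all add: h.hom_0 h.hom_add h.hom_mult * map_poly_pCons)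
qed

subsection \<open>Substitution endomorphisms\<close>

lemma rf_dx_eval: "rf_dx (rf_eval u v P) = rf_eval u v (map_poly pderiv P) * rf_dx u + rf_eval u v (pderiv P) * rf_dx v"
  and rf_dy_eval: "rf_dy (rf_eval u v P) = rf_eval u v (map_poly pderiv P) * rf_dy u + rf_eval u v (pderiv P) * rf_dy v"
  unfolding rf_eval_def
  by (rule dx.chain_poly_poly dy.chain_poly_poly; simp add: rf_const.coeff_hom_axioms)+

definition rf_subst :: "'k::field ratfun2 \<Rightarrow> 'k ratfun2 \<Rightarrow> 'k ratfun2 \<Rightarrow> 'k ratfun2" where
  "rf_subst u v q = rf_eval u v (fst (rep_fract q)) / rf_eval u v (snd (rep_fract q))"

text \<open>In characteristic zero a nonvanishing Jacobian makes \<open>u\<close> and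
  \<open>v\<close> algebraically independent. Nonzero denominators therefore stay nonzero under
  evaluation, so \<open>rf_subst u v\<close> does not depend on the representative chosen by
  \<open>rep_fract\<close>.\<close>

locale rf_substitution =
  fixes u v :: "'k::field_char_0 ratfun2"
  assumes jacobian: "rf_dx u * rf_dy v - rf_dy u * rf_dx v \<noteq> 0"
begin

sublocale eval: coeff_hom "rf_eval u v"
  by (rule rf_eval_hom)

text \<open>Descent on the degree: differentiating p(u) = 0 in both directions gives p'(u) = 0,
  since the Jacobian keeps the two partial derivatives of \<open>u\<close> from vanishing together.
  By induction p' = 0, so p is a constant, necessarily zero.\<close>

lemma eval_x_nonzero: "p \<noteq> 0 \<Longrightarrow> poly (map_poly rf_const p) u \<noteq> 0"
proof (induction "degree p" arbitrary: p rule: less_induct)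
  case less
  show ?case
  proof
    assume 0: "poly (map_poly rf_const p) u = 0"
    have "poly (map_poly rf_const (pderiv p)) u * rf_dx u = 0"
      "poly (map_poly rf_const (pderiv p)) u * rf_dy u = 0"
      using dx.chain_poly[OF rf_const.coeff_hom_axioms, of p u] dy.chain_poly[OF rf_const.coeff_hom_axioms, of p u] 0
      by (simp_all add: dx.zero dy.zero)
    then have "poly (map_poly rf_const (pderiv p)) u = 0"
      using jacobian by auto
    then have "pderiv p = 0"
      using less(1)[of "pderiv p"] by (cases "degree p = 0") (auto simp: degree_pderiv pderiv_eq_0_iff)
    then obtain c where "p = [:c:]"
      by (metis pderiv_eq_0_iff degree_eq_zeroE)
    then show False
      using 0 less(2) by (simp add: rf_const.map_poly_hom_pCons)
  qed
qed

text \<open>The same descent on the degree in y; once P has degree 0 in y,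
  \<open>eval_x_nonzero\<close> finishes.\<close>

lemma eval_nonzero: "P \<noteq> 0 \<Longrightarrow> rf_eval u v P \<noteq> 0"
proof (induction "degree P" arbitrary: P rule: less_induct)
  case less
  show ?case
  proof
    assume 0: "rf_eval u v P = 0"
    define a b where "a = rf_eval u v (map_poly pderiv P)" and "b = rf_eval u v (pderiv P)"
    have "a * rf_dx u + b * rf_dx v = 0" "a * rf_dy u + b * rf_dy v = 0"
      using rf_dx_eval[of u v P] rf_dy_eval[of u v P] 0
      by (simp_all add: dx.zero dy.zero a_def b_def)
    \<comment> \<open>Cramer's rule: this combination of the two equations eliminates
      \<open>a\<close>.\<close>
    moreover have "b * (rf_dx u * rf_dy v - rf_dy u * rf_dx v) =
        rf_dx u * (a * rf_dy u + b * rf_dy v) - rf_dy u * (a * rf_dx u + b * rf_dx v)"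
      by (simp add: algebra_simps)
    ultimately have "b = 0"
      using jacobian by simp
    then have "pderiv P = 0"
      using less(1)[of "pderiv P"] unfolding b_def
      by (cases "degree P = 0") (auto simp: degree_pderiv pderiv_eq_0_iff)
    then obtain c where "P = [:c:]"
      by (metis pderiv_eq_0_iff degree_eq_zeroE)
    then show False
      using 0 less(2) eval_x_nonzero[of c] by (simp add: rf_eval_def map_poly_pCons)
  qed
qed

lemma subst_Fract:
  assumes "b \<noteq> 0"
  shows "rf_subst u v (Fraction_Field.Fract a b) = rf_eval u v a / rf_eval u v b"
proof -
  let ?q = "rep_fract (Fraction_Field.Fract a b)"
  have "Fraction_Field.Fract (fst ?q) (snd ?q) = Fraction_Field.Fract a b" and nz: "snd ?q \<noteq> 0"
    by (simp_all add: Fract_rep_fract)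
  then have "rf_eval u v (fst ?q * b) = rf_eval u v (a * snd ?q)"
    using assms by (simp add: eq_fract)
  then show ?thesis
    using eval_nonzero assms nz by (simp add: rf_subst_def eval.hom_mult field_simps)
qed

lemma subst_to_fract: "rf_subst u v (to_fract P) = rf_eval u v P"
  by (simp add: to_fract_def subst_Fract eval.hom_1)

lemma subst_X [simp]: "rf_subst u v rf_X = u"
  and subst_Y [simp]: "rf_subst u v rf_Y = v"
  and subst_const [simp]: "rf_subst u v (rf_const c) = rf_const c"
  by (simp_all add: rf_X_def rf_Y_def subst_to_fract rf_eval_def map_poly_pCons
      rf_const.hom_0 rf_const.hom_1 flip: one_pCons)
    (simp add: rf_const_def subst_to_fract rf_eval_def map_poly_pCons)

sublocale subst: coeff_hom "rf_subst u v"
proof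
  fix q r :: "'k ratfun2"
  obtain a b c d where q: "q = Fraction_Field.Fract a b" "b \<noteq> 0" and r: "r = Fraction_Field.Fract c d" "d \<noteq> 0"
    by (metis Fract_cases)
  show "rf_subst u v (q + r) = rf_subst u v q + rf_subst u v r"
    "rf_subst u v (q * r) = rf_subst u v q * rf_subst u v r"
    using q r eval_nonzero by (simp_all add: subst_Fract eval.hom_add eval.hom_mult field_simps)
qed (use subst_to_fract[of 1] in \<open>simp add: eval.hom_1\<close>)

lemma subst_divide: "rf_subst u v (a / b) = rf_subst u v a / rf_subst u v b"
proof (cases "b = 0")
  case False
  have "rf_subst u v (a / b) * rf_subst u v b = rf_subst u v a"
    "rf_subst u v (1 / b) * rf_subst u v b = 1"
    using False by (simp_all add: subst.hom_1 flip: subst.hom_mult)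
  then show ?thesis
    by (metis mult_zero_right nonzero_eq_divide_eq zero_neq_one)
qed (simp add: subst.hom_0)

lemma subst_power: "rf_subst u v (a ^ n) = rf_subst u v a ^ n"
  by (induction n) (simp_all add: subst.hom_1 subst.hom_mult)

lemma rf_dx_subst: "rf_dx (rf_subst u v q) = rf_subst u v (rf_dx q) * rf_dx u + rf_subst u v (rf_dy q) * rf_dx v"
  and rf_dy_subst: "rf_dy (rf_subst u v q) = rf_subst u v (rf_dx q) * rf_dy u + rf_subst u v (rf_dy q) * rf_dy v"
proof -
  obtain a b where q: "q = to_fract a / to_fract b" "b \<noteq> 0"
    by (metis Fract_cases Fract_conv_to_fract)
  have b: "to_fract b \<noteq> 0" "rf_eval u v b \<noteq> 0"
    using q eval_nonzero by simp_all
  show "rf_dx (rf_subst u v q) = rf_subst u v (rf_dx q) * rf_dx u + rf_subst u v (rf_dy q) * rf_dx v"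
    "rf_dy (rf_subst u v q) = rf_subst u v (rf_dx q) * rf_dy u + rf_subst u v (rf_dy q) * rf_dy v"
    unfolding q(1) using b
    by (simp_all add: dx.divide dy.divide subst_divide subst_to_fract rf_dx_to_fract rf_dy_to_fract rf_dx_eval rf_dy_eval
        subst.hom_diff subst.hom_mult subst_power field_simps)
qed

text \<open>By the chain rule the bracket of two images is the substituted Jacobian times the
  bracket of \<open>u\<close> and \<open>v\<close>, so compatibility has to be checked on the
  generators only.\<close>

lemma poisson_endomorphism_subst:
  assumes "poisson_bracket f u v = rf_subst u v f"
  shows "poisson_endomorphism f (rf_subst u v)"
proof -
  have "rf_subst u v (poisson_bracket f g h) = poisson_bracket f (rf_subst u v g) (rf_subst u v h)" for g h
  proof -
    have "poisson_bracket f (rf_subst u v g) (rf_subst u v h) =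
        (rf_subst u v (rf_dx g) * rf_subst u v (rf_dy h) - rf_subst u v (rf_dy g) * rf_subst u v (rf_dx h))
          * poisson_bracket f u v"
      by (simp add: poisson_bracket_def rf_dx_subst rf_dy_subst algebra_simps)
    then show ?thesis
      by (simp add: assms) (simp add: poisson_bracket_def subst.hom_mult subst.hom_diff)
  qed
  then show ?thesis
    by (simp add: poisson_endomorphism_def algebra_endomorphism_def subst.hom_add subst.hom_mult)
qed

end

lemma subst_eq_self_if_hom:
  assumes "rf_substitution u v"
    and h: "coeff_hom h" "\<And>c. h (rf_const c) = rf_const c" "h u = u" "h v = v"
  shows "h (rf_subst u v q) = rf_subst u v q"
proof -
  interpret rf_substitution u v by fact
  interpret h: coeff_hom h by fact
  have ev: "h (rf_eval u v P) = rf_eval u v P" for P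
    using hom_rf_eval[OF h(1,2), of u v P] h(3,4) by simp
  obtain a b where q: "q = Fraction_Field.Fract a b" "b \<noteq> 0"
    by (metis Fract_cases)
  have "h (rf_subst u v q) * h (rf_eval u v b) = h (rf_eval u v a)"
    using q eval_nonzero[of b] by (simp add: subst_Fract flip: h.hom_mult)
  then show ?thesis
    using q eval_nonzero[of b] by (simp add: subst_Fract ev field_simps)
qed

text \<open>Everything in the image of \<open>rf_subst u v\<close> is fixed by
  \<open>rf_subst s t\<close>. If the former were onto, the latter would be the identity, yet it
  moves a generator.\<close>

lemma not_dixmier_if_symmetric:
  assumes "rf_substitution u v" and bracket: "poisson_bracket f u v = rf_subst u v f"
    and "rf_substitution s t" and fixed: "rf_subst s t u = u" "rf_subst s t v = v"
    and nontrivial: "s \<noteq> rf_X \<or> t \<noteq> rf_Y"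
  shows "\<not> dixmier_property f"
proof
  interpret uv: rf_substitution u v by fact
  interpret st: rf_substitution s t by fact
  assume "dixmier_property f"
  then have "surj (rf_subst u v)"
    using uv.poisson_endomorphism_subst[OF bracket] by (simp add: dixmier_property_def bij_def)
  moreover have "rf_subst s t (rf_subst u v q) = rf_subst u v q" for q
    using assms(1) st.subst.coeff_hom_axioms st.subst_const fixed by (rule subst_eq_self_if_hom)
  ultimately have "rf_subst s t q = q" for q
    by (metis surjD)
  from this[of rf_X] this[of rf_Y] show False
    using nontrivial by (metis st.subst_X st.subst_Y)
qed

subsection \<open>Non-surjective endomorphisms\<close>

lemma rf_X_nonzero [simp]: "rf_X \<noteq> 0"
  and rf_Y_nonzero [simp]: "rf_Y \<noteq> 0"
  by (simp_all add: rf_X_def rf_Y_def)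

lemma rf_of_nat: "of_nat n = rf_const (of_nat n)"
  by (simp add: rf_const.hom_of_nat)

lemma rf_of_nat_eq_0_iff [simp]: "(of_nat n :: 'k::field_char_0 ratfun2) = 0 \<longleftrightarrow> n = 0"
  by (simp add: rf_of_nat)

lemma rf_two_nonzero [simp]: "(2 :: 'k::field_char_0 ratfun2) \<noteq> 0"
  using rf_of_nat_eq_0_iff[of 2, where 'k = 'k] by simp

lemma rf_neg_nonzero_neq: "a \<noteq> 0 \<Longrightarrow> - a \<noteq> (a :: 'k::field_char_0 ratfun2)"
  using rf_two_nonzero[where 'k = 'k] by (metis add.left_inverse mult_2 mult_eq_0_iff)

lemma rf_Y_sq_neq_1: "rf_Y\<^sup>2 \<noteq> (1 :: 'k::field ratfun2)"
  by (simp add: rf_Y_def power2_eq_square one_pCons flip: to_fract_mult to_fract_1)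

lemma rf_poly_x_mult_X: "rf_poly_x p * rf_X = rf_poly_x (pCons 0 p)"
  by (simp add: rf_poly_x_def rf_X_def flip: to_fract_mult)

text \<open>Replacing x by 2x multiplies the coefficient by 2^(n+1), while {2x, y^N} = 2 N y^(N-1)
  {x, y}; the two sides match for N = 2^n. As n > 0, this N is even and the image is fixed by y ->
  -y.\<close>

lemma not_dixmier_monom:
  fixes c :: "'k::field_char_0"
  assumes "n > 0"
  shows "\<not> dixmier_property (rf_const c * rf_X ^ Suc n * rf_Y)" (is "\<not> dixmier_property ?f")
proof -
  define N :: nat where "N = 2 ^ n"
  have N: "even N" and NN: "of_nat N = rf_const (2 :: 'k) ^ n"
    using assms rf_const.hom_of_nat[of 2, where 'a = 'k] by (simp_all add: N_def)
  obtain M where M: "N = Suc M"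
    by (cases N) (auto simp: N_def)
  interpret phi: rf_substitution "rf_const 2 * rf_X" "rf_Y ^ N :: 'k ratfun2"
    by standard (simp add: dx.power dy.power dx.mult dy.mult NN)
  interpret sigma: rf_substitution rf_X "- rf_Y :: 'k ratfun2"
    by standard (simp add: dx.minus dy.minus)
  have "poisson_bracket ?f (rf_const 2 * rf_X) (rf_Y ^ N) = rf_subst (rf_const 2 * rf_X) (rf_Y ^ N) ?f"
    unfolding phi.subst.hom_mult phi.subst_power phi.subst_X phi.subst_Y phi.subst_const
    by (simp add: poisson_bracket_def dx.power dy.power dx.mult dy.mult NN power_mult_distrib)
      (simp add: M algebra_simps)
  then show ?thesis
    by (rule not_dixmier_if_symmetric[OF phi.rf_substitution_axioms _ sigma.rf_substitution_axioms])
      (use N in \<open>simp_all add: sigma.subst_power sigma.subst.hom_mult rf_neg_nonzero_neq\<close>)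
qed

text \<open>
  The fixed field of the involution \<open>w \<mapsto> 1 / w\<close>, \<open>y \<mapsto> 1 / y\<close> of \<open>k(w, y)\<close> is again
  a Poisson field of the same type: in additive coordinates \<open>w = exp a\<close>, \<open>y = exp b\<close> its
  generators are \<open>sinh a / sinh b\<close> and \<open>sinh (a + b) / sinh b\<close>.
\<close>

definition rf_inv_u :: "'k::field ratfun2 \<Rightarrow> 'k ratfun2 \<Rightarrow> 'k ratfun2" where
  "rf_inv_u w y = y * (w\<^sup>2 - 1) / (w * (y\<^sup>2 - 1))"

definition rf_inv_v :: "'k::field ratfun2 \<Rightarrow> 'k ratfun2 \<Rightarrow> 'k ratfun2" where
  "rf_inv_v w y = (w\<^sup>2 * y\<^sup>2 - 1) / (w * (y\<^sup>2 - 1))"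

lemma rf_inv_inverse:
  assumes "w \<noteq> 0" "y \<noteq> 0" "y\<^sup>2 \<noteq> 1"
  shows "rf_inv_u (1 / w) (1 / y) = rf_inv_u w y" "rf_inv_v (1 / w) (1 / y) = rf_inv_v w y"
proof -
  have "y\<^sup>2 - 1 \<noteq> 0" "1 / y\<^sup>2 - 1 \<noteq> 0" using assms by (auto simp: field_simps)
  then show "rf_inv_u (1 / w) (1 / y) = rf_inv_u w y" "rf_inv_v (1 / w) (1 / y) = rf_inv_v w y"
    unfolding rf_inv_u_def rf_inv_v_def using assms
    by (simp_all add: power_divide divide_simps) (simp_all add: algebra_simps power2_eq_square)
qed

lemma jacobian_rf_inv:
  fixes w :: "'k::field_char_0 ratfun2"
  assumes w: "w \<noteq> 0" and dy: "rf_dy w = 0"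
  shows "rf_dx (rf_inv_u w rf_Y) * rf_dy (rf_inv_v w rf_Y) - rf_dy (rf_inv_u w rf_Y) * rf_dx (rf_inv_v w rf_Y) =
    rf_inv_u w rf_Y * rf_inv_v w rf_Y * rf_dx w / (w * rf_Y)"
proof -
  have Y: "rf_Y\<^sup>2 - 1 \<noteq> (0 :: 'k ratfun2)" "rf_Y \<noteq> (0 :: 'k ratfun2)"
    using rf_Y_sq_neq_1 by simp_all
  let ?y = "rf_Y :: 'k ratfun2"
  have d1: "rf_dx (rf_inv_u w ?y) = ?y * (w\<^sup>2 + 1) * rf_dx w / (w\<^sup>2 * (?y\<^sup>2 - 1))"
    unfolding rf_inv_u_def using w Y 
    by (simp add: dx.divide dx.mult dx.diff dx.one dx.power divide_simps) (simp add: algebra_simps power2_eq_square)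
  have d2: "rf_dy (rf_inv_u w ?y) = - (w\<^sup>2 - 1) * (?y\<^sup>2 + 1) / (w * (?y\<^sup>2 - 1)\<^sup>2)"
    unfolding rf_inv_u_def using w Y dy
    by (simp add: dy.divide dy.mult dy.diff dy.one dy.power divide_simps) (simp add: algebra_simps power2_eq_square)
  have d3: "rf_dx (rf_inv_v w ?y) = (w\<^sup>2 * ?y\<^sup>2 + 1) * rf_dx w / (w\<^sup>2 * (?y\<^sup>2 - 1))"
    unfolding rf_inv_v_def using w Y
    by (simp add: dx.divide dx.mult dx.diff dx.one dx.power divide_simps) (simp add: algebra_simps power2_eq_square)
  have d4: "rf_dy (rf_inv_v w ?y) = - (2 * ?y * (w\<^sup>2 - 1)) / (w * (?y\<^sup>2 - 1)\<^sup>2)"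
    unfolding rf_inv_v_def using w Y dy
    by (simp add: dy.divide dy.mult dy.diff dy.one dy.power divide_simps) (simp add: algebra_simps power2_eq_square)
  show ?thesis
    unfolding d1 d2 d3 d4 unfolding rf_inv_u_def rf_inv_v_def using w Y
    by (simp add: divide_simps) (simp add: algebra_simps power2_eq_square)
qed

text \<open>By \<open>jacobian_rf_inv\<close> the product could vanish only through u or v, that is,
  if w^2 = 1 or w^2 y^2 = 1. Differentiating the first in x and the second in y refutes
  them.\<close>

lemma jacobian_rf_inv_nonzero:
  fixes w :: "'k::field_char_0 ratfun2"
  assumes w: "w \<noteq> 0" and dy: "rf_dy w = 0" and dx: "rf_dx w \<noteq> 0"
  shows "rf_dx (rf_inv_u w rf_Y) * rf_dy (rf_inv_v w rf_Y) - rf_dy (rf_inv_u w rf_Y) * rf_dx (rf_inv_v w rf_Y) \<noteq> 0"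
proof -
  have "w\<^sup>2 \<noteq> 1"
  proof
    assume "w\<^sup>2 = 1"
    then have "rf_dx (w\<^sup>2) = 0" by (simp add: dx.one)
    then show False using w dx by (simp add: dx.power)
  qed
  moreover have "w\<^sup>2 * rf_Y\<^sup>2 \<noteq> 1"
  proof
    assume "w\<^sup>2 * rf_Y\<^sup>2 = 1"
    then have "rf_dy (w\<^sup>2 * rf_Y\<^sup>2) = 0" by (simp add: dy.one)
    then show False using w dy by (simp add: dy.power dy.mult)
  qed
  ultimately show ?thesis
    using w dx rf_Y_sq_neq_1[where 'k = 'k]
    by (simp add: jacobian_rf_inv dy) (simp add: rf_inv_u_def rf_inv_v_def)
qed

lemma rf_inv_Y_neq: "1 / rf_Y \<noteq> (rf_Y :: 'k::field ratfun2)"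
  using rf_Y_sq_neq_1[where 'k = 'k] by (auto simp: divide_simps power2_eq_square)

lemma rf_substitution_inverse_Y:
  "rf_dx s \<noteq> 0 \<Longrightarrow> rf_dy s = 0 \<Longrightarrow> rf_substitution s (1 / rf_Y :: 'k::field_char_0 ratfun2)"
  by standard (simp add: dx.divide dy.divide dx.one dy.one)

lemma (in rf_substitution) subst_rf_inv:
  "rf_subst u v (rf_inv_u w y) = rf_inv_u (rf_subst u v w) (rf_subst u v y)"
  "rf_subst u v (rf_inv_v w y) = rf_inv_v (rf_subst u v w) (rf_subst u v y)"
  by (simp_all add: rf_inv_u_def rf_inv_v_def subst_divide subst.hom_mult subst_power subst.hom_diff subst.hom_1)

lemma not_dixmier_const: "\<not> dixmier_property (rf_const (c :: 'k::field_char_0) * rf_X * rf_Y)" (is "\<not> dixmier_property ?f")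
proof -
  define u v where "u = rf_inv_u rf_X (rf_Y :: 'k ratfun2)" and "v = rf_inv_v rf_X (rf_Y :: 'k ratfun2)"
  interpret phi: rf_substitution u v
    by standard (use jacobian_rf_inv_nonzero[of rf_X] in \<open>simp add: u_def v_def\<close>)
  interpret sigma: rf_substitution "1 / rf_X" "1 / rf_Y :: 'k ratfun2"
    by (rule rf_substitution_inverse_Y) (simp_all add: dx.divide dy.divide dx.one dy.one)
  have "poisson_bracket ?f u v = u * v / (rf_X * rf_Y) * ?f"
    by (simp add: poisson_bracket_def u_def v_def jacobian_rf_inv)
  also have "\<dots> = rf_subst u v ?f"
    by (simp add: phi.subst.hom_mult)
  finally show ?thesis
    by (rule not_dixmier_if_symmetric[OF phi.rf_substitution_axioms _ sigma.rf_substitution_axioms])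
      (simp_all add: u_def v_def sigma.subst_rf_inv rf_inv_inverse rf_inv_Y_neq rf_Y_sq_neq_1)
qed

text \<open>In the coordinate w = (x - a)/x the bracket becomes {w, y} = a c w y, which is the
  situation of \<open>not_dixmier_const\<close>. The endomorphism w -> u, y -> v is then rewritten
  in terms of x.\<close>

lemma not_dixmier_linear:
  fixes a c :: "'k::field_char_0"
  assumes "a \<noteq> 0"
  shows "\<not> dixmier_property (rf_const c * (rf_X - rf_const a) * rf_X * rf_Y)" (is "\<not> dixmier_property ?f")
proof -
  have "rf_X \<noteq> rf_const a"
    by (metis rf_dx_X rf_dx_const zero_neq_one)
  then have Xa: "rf_X - rf_const a \<noteq> 0" "rf_X \<noteq> rf_const a"
    by simp_all
  define w where "w = (rf_X - rf_const a) / rf_X"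
  have w: "w \<noteq> 0" "rf_dy w = 0" "rf_dx w = rf_const a / rf_X\<^sup>2"
    using Xa by (simp_all add: w_def dx.divide dy.divide dx.diff dy.diff power2_eq_square)
  define u v where "u = rf_inv_u w rf_Y" and "v = rf_inv_v w rf_Y"
  have nz: "rf_dx u * rf_dy v - rf_dy u * rf_dx v \<noteq> 0"
    using jacobian_rf_inv_nonzero[of w] w assms by (simp add: u_def v_def)
  then have u: "1 - u \<noteq> 0"
    by (auto simp: dx.one dy.one)
  \<comment> \<open>The image of x under the inverse Moebius map: \<open>X'\<close> solves (X' -
    a)/X' = u.\<close>
  define X' where "X' = rf_const a / (1 - u)"
  have X': "rf_dx X' = rf_const a / (1 - u)\<^sup>2 * rf_dx u" "rf_dy X' = rf_const a / (1 - u)\<^sup>2 * rf_dy u"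
    using u by (simp_all add: X'_def dx.divide dy.divide dx.diff dy.diff dx.one dy.one)
  have J: "rf_dx X' * rf_dy v - rf_dy X' * rf_dx v =
      rf_const a / (1 - u)\<^sup>2 * (rf_dx u * rf_dy v - rf_dy u * rf_dx v)"
    unfolding X' by (simp add: algebra_simps diff_divide_distrib)
  interpret phi: rf_substitution X' v
    by standard (use nz u assms in \<open>simp add: J\<close>)
  \<comment> \<open>In terms of x, the inversion w -> 1/w is x -> a - x.\<close>
  interpret sigma: rf_substitution "rf_const a - rf_X" "1 / rf_Y :: 'k ratfun2"
    by (rule rf_substitution_inverse_Y) (simp_all add: dx.diff dy.diff)
  have "poisson_bracket ?f X' v =
      rf_const a / (1 - u)\<^sup>2 * (u * v * (rf_const a / rf_X\<^sup>2) / (w * rf_Y)) * ?f"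
    using w by (simp only: poisson_bracket_def J) (simp add: u_def v_def jacobian_rf_inv)
  also have "\<dots> = rf_const c * (X' - rf_const a) * X' * v"
    using Xa u by (simp add: X'_def w_def divide_simps) (simp add: algebra_simps power2_eq_square)
  also have "\<dots> = rf_subst X' v ?f"
    by (simp add: phi.subst.hom_mult phi.subst.hom_diff)
  finally have "poisson_bracket ?f X' v = rf_subst X' v ?f" .
  moreover have "rf_subst (rf_const a - rf_X) (1 / rf_Y) w = 1 / w"
    using Xa by (simp add: w_def sigma.subst_divide sigma.subst.hom_diff divide_simps) (simp add: algebra_simps)
  then have "rf_subst (rf_const a - rf_X) (1 / rf_Y) u = u" "rf_subst (rf_const a - rf_X) (1 / rf_Y) v = v"
    using w by (simp_all add: u_def v_def sigma.subst_rf_inv rf_inv_inverse rf_Y_sq_neq_1)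
  ultimately show ?thesis
    by (intro not_dixmier_if_symmetric[OF phi.rf_substitution_axioms _ sigma.rf_substitution_axioms])
      (simp_all add: X'_def sigma.subst_divide sigma.subst.hom_diff sigma.subst.hom_1 rf_inv_Y_neq)
qed

subsection \<open>Denominators\<close>

interpretation pdx: derivation "map_poly pderiv :: 'k::field poly poly \<Rightarrow> _"
  by standard (simp_all add: map_poly_pderiv_add map_poly_pderiv_mult)

interpretation pdy: derivation "pderiv :: 'k::field poly poly \<Rightarrow> _"
  by standard (simp_all add: pderiv_add pderiv_mult)

text \<open>One derivative may cost one factor \<pi>, but the determinant of two derivatives also
  costs only one: the terms in which both derivatives hit the powers of \<pi> are multiples of the
  product of \<open>D1 \<pi>\<close> and \<open>D2 \<pi>\<close> and cancel.\<close>

lemma power_dvd_jacobian: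
  assumes "derivation D1" "derivation D2" and pi: "\<pi> \<noteq> (0 :: 'a::idom)"
    and P: "\<pi> ^ i dvd P" and Q: "\<pi> ^ j dvd Q"
  shows "\<pi> ^ (i + j) dvd \<pi> * (D1 P * D2 Q - D2 P * D1 Q)"
proof -
  interpret D1: derivation D1 by fact
  interpret D2: derivation D2 by fact
  obtain p q where p: "P = \<pi> ^ i * p" and q: "Q = \<pi> ^ j * q"
    using P Q by (auto elim!: dvdE)
  have pow: "\<pi> * D (\<pi> ^ n * r) = \<pi> ^ n * (of_nat n * r * D \<pi> + \<pi> * D r)" if "derivation D" for D n r
  proof -
    interpret derivation D by fact
    have "\<pi> * D (\<pi> ^ n) = of_nat n * \<pi> ^ n * D \<pi>"
      using power[of \<pi> n] by (cases n) (simp_all add: algebra_simps)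
    then show ?thesis
      by (simp add: mult algebra_simps)
  qed
  let ?m = "of_nat i * p" and ?n = "of_nat j * q"
  have "\<pi> * (\<pi> * (D1 P * D2 Q - D2 P * D1 Q)) = (\<pi> * D1 P) * (\<pi> * D2 Q) - (\<pi> * D2 P) * (\<pi> * D1 Q)"
    by (simp add: algebra_simps)
  also have "\<dots> = \<pi> * (\<pi> ^ (i + j) * (?m * (D1 \<pi> * D2 q - D2 \<pi> * D1 q) + ?n * (D1 p * D2 \<pi> - D2 p * D1 \<pi>)
      + \<pi> * (D1 p * D2 q - D2 p * D1 q)))"
    unfolding p q pow[OF D1.derivation_axioms] pow[OF D2.derivation_axioms]
    by (simp add: power_add algebra_simps)
  finally show ?thesis
    using pi by simp
qed

text \<open>For d = \<open>degree f\<close> this is B^d f(A/B) with the denominators cleared;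
  \<open>h\<close> embeds the coefficients.\<close>

definition homogenize :: "('a::idom \<Rightarrow> 'b::idom) \<Rightarrow> 'a poly \<Rightarrow> 'b \<Rightarrow> 'b \<Rightarrow> 'b" where
  "homogenize h f A B = (\<Sum>i\<le>degree f. h (poly.coeff f i) * A ^ i * B ^ (degree f - i))"

lemma homogenize_scale: "homogenize h f (g * A) (g * B) = g ^ degree f * homogenize h f A B"
  unfolding homogenize_def sum_distrib_left
proof (rule sum.cong)
  fix i assume "i \<in> {..degree f}"
  then have "g ^ degree f = g ^ i * g ^ (degree f - i)"
    by (simp flip: power_add)
  then show "h (poly.coeff f i) * (g * A) ^ i * (g * B) ^ (degree f - i) =
      g ^ degree f * (h (poly.coeff f i) * A ^ i * B ^ (degree f - i))"
    by (simp add: power_mult_distrib)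
qed simp

lemma (in coeff_hom) homogenize_1: "homogenize h f A 1 = poly (map_poly h f) A"
proof -
  have "degree (map_poly h f) \<le> degree f"
    by (intro degree_le) (simp add: coeff_map_poly_hom coeff_eq_0 hom_0)
  then show ?thesis
    by (auto simp: homogenize_def poly_altdef coeff_map_poly_hom coeff_eq_0 simp flip: coeff_map_poly_hom
        intro!: sum.mono_neutral_right le_degree)
qed

lemma homogenize_lead: "\<exists>R. homogenize h f A B = h (lead_coeff f) * A ^ degree f + B * R"
proof -
  have "B dvd (\<Sum>i<degree f. h (poly.coeff f i) * A ^ i * B ^ (degree f - i))"
    by (intro dvd_sum dvd_mult dvd_power) simp
  then show ?thesis
    by (auto simp: homogenize_def lessThan_Suc_atMost[symmetric] elim!: dvdE)
qed

text \<open>The numerator of the Jacobian of A/B and C/E over the denominator B^2 E^2; see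
  \<open>jacobian_fraction\<close>.\<close>

definition frac_jacobian :: "'k::field poly poly \<Rightarrow> 'k poly poly \<Rightarrow> 'k poly poly \<Rightarrow> 'k poly poly \<Rightarrow> 'k poly poly" where
  "frac_jacobian A B C E =
    (map_poly pderiv A * B - A * map_poly pderiv B) * (pderiv C * E - C * pderiv E) -
    (pderiv A * B - A * pderiv B) * (map_poly pderiv C * E - C * map_poly pderiv E)"

lemma frac_jacobian_scale: "frac_jacobian (g * A) (g * B) C E = g\<^sup>2 * frac_jacobian A B C E"
  by (simp add: frac_jacobian_def pdx.mult pdy.mult power2_eq_square algebra_simps)

text \<open>The expression expands into four ordinary Jacobians, each multiplied by the two entries
  missing from it. Every term thus collects the powers in B, C and E, with A counted with exponent
  0, and loses one factor \<pi> at most.\<close>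

lemma power_dvd_frac_jacobian:
  assumes "\<pi> \<noteq> 0" "\<pi> ^ i dvd B" "\<pi> ^ j dvd C" "\<pi> ^ l dvd E"
  shows "\<pi> ^ (i + j + l) dvd \<pi> * frac_jacobian A B C E"
proof -
  define br where "br P Q = map_poly pderiv P * pderiv Q - pderiv P * map_poly pderiv Q" for P Q :: "'a poly poly"
  have br: "\<pi> ^ (m + n) dvd \<pi> * br P Q" if "\<pi> ^ m dvd P" "\<pi> ^ n dvd Q" for m n P Q
    unfolding br_def using pdx.derivation_axioms pdy.derivation_axioms assms(1) that by (rule power_dvd_jacobian)
  have "\<pi> * frac_jacobian A B C E =
      B * E * (\<pi> * br A C) - B * C * (\<pi> * br A E) - A * E * (\<pi> * br B C) + A * C * (\<pi> * br B E)"
    by (simp add: frac_jacobian_def br_def algebra_simps)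
  moreover have "\<pi> ^ ((i + l) + (0 + j)) dvd B * E * (\<pi> * br A C)"
    unfolding power_add[of \<pi> "i + l"] by (intro mult_dvd_mono br) (use assms in \<open>auto simp: power_add mult_dvd_mono\<close>)
  moreover have "\<pi> ^ ((i + j) + (0 + l)) dvd B * C * (\<pi> * br A E)"
    unfolding power_add[of \<pi> "i + j"] by (intro mult_dvd_mono br) (use assms in \<open>auto simp: power_add mult_dvd_mono\<close>)
  moreover have "\<pi> ^ (l + (i + j)) dvd A * E * (\<pi> * br B C)"
    unfolding power_add[of \<pi> l] by (intro mult_dvd_mono br) (use assms in auto)
  moreover have "\<pi> ^ (j + (i + l)) dvd A * C * (\<pi> * br B E)"
    unfolding power_add[of \<pi> j] by (intro mult_dvd_mono br) (use assms in auto)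
  ultimately show ?thesis
    by (simp add: ac_simps)
qed

text \<open>
  The decisive point is that logarithmic derivatives have at most simple poles
  (lemma \<open>power_dvd_frac_jacobian\<close>), even along a curve where \<open>Y = C / E\<close> has a zero or a pole.
\<close>

lemma no_pole:
  fixes A B C E w :: "'k::{field,factorial_ring_gcd,semiring_gcd_mult_normalize} poly poly"
  assumes nz: "B \<noteq> 0" "C \<noteq> 0" "E \<noteq> 0" and deg: "degree f \<ge> 3"
    and pi: "prime_elem \<pi>" "\<pi> dvd B" "\<not> \<pi> dvd A"
    and eq: "frac_jacobian A B C E * w * B ^ (degree f - 2) = homogenize (\<lambda>c. [:[:c:]:]) f A B * C * E"
  shows False
proof -
  let ?F = "homogenize (\<lambda>c. [:[:c:]:]) f A B"
  have pi0: "\<pi> \<noteq> 0" "\<not> is_unit \<pi>"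
    using pi by (auto simp: prime_elem_def)
  define e s t where "e = multiplicity \<pi> B" and "s = multiplicity \<pi> C" and "t = multiplicity \<pi> E"
  have e: "e > 0"
    using pi nz pi0 by (simp add: e_def multiplicity_gt_zero_iff)
  obtain C' where C': "C = \<pi> ^ s * C'" "\<not> \<pi> dvd C'"
    using multiplicity_decompose'[OF nz(2) pi0(2)] by (auto simp: s_def)
  obtain E' where E': "E = \<pi> ^ t * E'" "\<not> \<pi> dvd E'"
    using multiplicity_decompose'[OF nz(3) pi0(2)] by (auto simp: t_def)
  have lc: "is_unit [:[:lead_coeff f:]:]"
    using deg by (auto simp: is_unit_const_poly_iff dvd_field_iff)
  \<comment> \<open>Since \<pi> divides B, only the leading term of f survives modulo \<pi>, and
    that is a unit times a power of A.\<close>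
  have F: "\<not> \<pi> dvd ?F"
  proof
    assume "\<pi> dvd ?F"
    moreover obtain R where "?F = [:[:lead_coeff f:]:] * A ^ degree f + B * R"
      using homogenize_lead by blast
    ultimately have "\<pi> dvd [:[:lead_coeff f:]:] * A ^ degree f"
      using pi(2) by (simp add: dvd_add_left_iff)
    then have "\<pi> dvd A ^ degree f"
      using lc by (metis dvd_mult_unit_iff')
    then show False
      using pi prime_elem_dvd_power by blast
  qed
  have B: "\<pi> ^ e dvd B"
    by (simp add: e_def multiplicity_dvd)
  \<comment> \<open>The exponent \<open>degree f - 2\<close> is positive, so the power of B supplies
    one more \<pi>, which makes up for the one lost in the Jacobian. The left side then has order at
    least e + s + t, the right side only s + t.\<close>
  have "\<pi> ^ (e + s + t) * \<pi> ^ 1 dvd (\<pi> * frac_jacobian A B C E) * (w * B ^ (degree f - 2))"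
    by (intro mult_dvd_mono power_dvd_frac_jacobian pi0 B dvd_mult)
      (use C' E' pi deg in \<open>auto intro: dvd_trans[OF pi(2) dvd_power]\<close>)
  also have "\<dots> = \<pi> * (?F * C * E)"
    unfolding eq[symmetric] by (simp add: ac_simps)
  also have "\<dots> = \<pi> ^ (s + t) * \<pi> * (?F * C' * E')"
    by (simp add: C'(1) E'(1) power_add ac_simps)
  finally have "\<pi> ^ e dvd ?F * C' * E'"
    using pi0 by (simp add: power_add ac_simps)
  then have "\<pi> dvd ?F * C' * E'"
    using e by (metis dvd_power dvd_trans)
  then show False
    using F C' E' pi(1) by (simp add: prime_elem_dvd_mult_iff)
qed

text \<open>Both sides are homogeneous of degree \<open>degree f\<close> in (A, B), so the gcd of A
  and B cancels from the equation. By \<open>no_pole\<close> the reduced denominator has no prime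
  divisor and is a unit.\<close>

lemma denominator_dvd_numerator:
  fixes A B C E w :: "'k::{field,factorial_ring_gcd,semiring_gcd_mult_normalize} poly poly"
  assumes nz: "B \<noteq> 0" "C \<noteq> 0" "E \<noteq> 0" and deg: "degree f \<ge> 3"
    and eq: "frac_jacobian A B C E * w * B ^ (degree f - 2) = homogenize (\<lambda>c. [:[:c:]:]) f A B * C * E"
  shows "B dvd A"
proof -
  define g where "g = gcd A B"
  have g: "g \<noteq> 0"
    using nz by (simp add: g_def)
  obtain A' B' where AB: "A = g * A'" "B = g * B'" and "coprime A' B'"
    using gcd_coprime_exists[of A B] g unfolding g_def by (metis mult.commute)
  have "2 + (degree f - 2) = degree f"
    using deg by simp
  then have gd: "g ^ degree f = g\<^sup>2 * g ^ (degree f - 2)"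
    by (metis power_add)
  have "g ^ degree f * (frac_jacobian A' B' C E * w * B' ^ (degree f - 2)) =
      frac_jacobian A B C E * w * B ^ (degree f - 2)"
    unfolding AB frac_jacobian_scale power_mult_distrib gd by (simp only: ac_simps)
  also have "\<dots> = g ^ degree f * (homogenize (\<lambda>c. [:[:c:]:]) f A' B' * C * E)"
    unfolding eq unfolding AB homogenize_scale by (simp only: ac_simps)
  finally have eq': "frac_jacobian A' B' C E * w * B' ^ (degree f - 2) = homogenize (\<lambda>c. [:[:c:]:]) f A' B' * C * E"
    using g by simp
  have "is_unit B'"
  proof (rule ccontr)
    assume "\<not> is_unit B'"
    then obtain \<pi> where "prime_elem \<pi>" "\<pi> dvd B'"
      using prime_divisor_exists[of B'] AB nz by (auto simp: prime_def)
    moreover from this have "\<not> \<pi> dvd A'"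
      using \<open>coprime A' B'\<close> by (meson coprime_common_divisor not_prime_elem_one prime_elem_not_unit)
    ultimately show False
      using no_pole[of B' C E f \<pi> A' w] AB nz deg eq' by auto
  qed
  then show ?thesis
    unfolding AB by (rule mult_dvd_mono[OF dvd_refl unit_imp_dvd])
qed

subsection \<open>Degrees in the second variable\<close>

lemma coeff_mult_le_degree:
  fixes p q :: "'a::idom poly"
  assumes "degree p \<le> m" "degree q \<le> n"
  shows "poly.coeff (p * q) (m + n) = poly.coeff p m * poly.coeff q n"
proof -
  have "poly.coeff (p * q) (m + n) = (\<Sum>i\<le>m + n. poly.coeff p i * poly.coeff q (m + n - i))"
    by (simp add: coeff_mult)
  also have "\<dots> = (\<Sum>i\<in>{m}. poly.coeff p i * poly.coeff q (m + n - i))"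
  proof (rule sum.mono_neutral_right)
    show "\<forall>i\<in>{..m + n} - {m}. poly.coeff p i * poly.coeff q (m + n - i) = 0"
    proof
      fix i assume "i \<in> {..m + n} - {m}"
      then have "i > m \<or> m + n - i > n"
        by auto
      then show "poly.coeff p i * poly.coeff q (m + n - i) = 0"
        using assms by (auto simp: coeff_eq_0)
    qed
  qed auto
  finally show ?thesis
    by simp
qed

text \<open>The Euler operator \<open>y \<partial>/\<partial>y\<close>, which in contrast to \<open>\<partial>/\<partial>y\<close> acts diagonally on coefficients.\<close>

definition euler :: "'a::idom poly \<Rightarrow> 'a poly" where
  "euler P = [:0, 1:] * pderiv P"

lemma coeff_euler: "poly.coeff (euler P) i = of_nat i * poly.coeff P i"
  by (cases i) (simp_all add: euler_def coeff_pderiv)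

lemma degree_euler_le: "degree (euler P) \<le> degree P"
  by (intro degree_le) (simp add: coeff_euler coeff_eq_0)

lemma degree_euler_wronskian_le: "degree (euler C * E - C * euler E) \<le> degree C + degree E"
  by (intro degree_diff_le order_trans[OF degree_mult_le] add_mono degree_euler_le order_refl)

text \<open>The Euler operator multiplies a leading coefficient by the degree, so the logarithmic
  Euler derivative of C/E has the value \<open>degree C - degree E\<close> at y = infinity. This
  integer becomes the exponent of y in the image of y.\<close>

lemma coeff_euler_wronskian:
  "poly.coeff (euler C * E - C * euler E) (degree C + degree E) =
    of_int (int (degree C) - int (degree E)) * (lead_coeff C * lead_coeff E)"
  by (simp add: coeff_mult_le_degree degree_euler_le coeff_euler) (simp add: algebra_simps)

lemma degree_map_pderiv_le: "degree (map_poly pderiv P) \<le> degree P"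
  by (intro degree_le) (simp add: coeff_map_poly coeff_eq_0)

text \<open>Both sides are homogeneous in the pair (Q B, B), so B^(degree f) cancels.\<close>

lemma homogenize_reduce:
  fixes Q B C E w :: "'k::field poly poly"
  assumes "B \<noteq> 0" "degree f \<ge> 2"
    and eq: "frac_jacobian (Q * B) B C E * w * B ^ (degree f - 2) = homogenize h f (Q * B) B * C * E"
  shows "frac_jacobian Q 1 C E * w = homogenize h f Q 1 * C * E"
proof -
  have "2 + (degree f - 2) = degree f"
    using assms by simp
  then have d: "B ^ degree f = B\<^sup>2 * B ^ (degree f - 2)"
    by (metis power_add)
  have "B ^ degree f * (frac_jacobian Q 1 C E * w) = frac_jacobian (B * Q) (B * 1) C E * w * B ^ (degree f - 2)"
    unfolding frac_jacobian_scale d by (simp only: ac_simps)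
  also have "\<dots> = homogenize h f (B * Q) (B * 1) * C * E"
    using eq by (simp add: mult.commute)
  also have "\<dots> = B ^ degree f * (homogenize h f Q 1 * C * E)"
    unfolding homogenize_scale by (simp only: ac_simps)
  finally show ?thesis
    using assms by simp
qed

lemma const_poly_hom: "coeff_hom (\<lambda>c :: 'a::idom. [:c:])"
  by standard simp_all

lemma const_const_poly_hom: "coeff_hom (\<lambda>c :: 'a::idom. [:[:c:]:])"
  by (intro coeff_hom_comp[OF const_poly_hom const_poly_hom])

lemma homogenize_const_1:
  "homogenize (\<lambda>c. [:[:c:]:]) f Q 1 = pcompose (map_poly (\<lambda>c. [:c:]) f) Q"
  unfolding coeff_hom.homogenize_1[OF const_const_poly_hom] pcompose_altdef
  by (simp add: map_poly_map_poly o_def)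

lemma pcompose_const_const: "pcompose (map_poly (\<lambda>c. [:c:]) f) [:q:] = [:pcompose f (q :: 'a::idom poly):]"
  by (induction f) (simp_all add: pcompose_pCons map_poly_pCons)

text \<open>Degrees in y come first: for Q of positive degree the right side would have larger
  degree, as \<open>degree f\<close> is at least 2. So Q = q(x), and the leading y-coefficients give
  m q' f = f(q). Degrees in x then force q to be affine, and cancelling m q' f yields the eigenvalue
  equation for C/E.\<close>

lemma polynomial_image_affine:
  fixes Q C E :: "'k::field_char_0 poly poly"
  assumes nz: "C \<noteq> 0" "E \<noteq> 0" and deg: "degree f \<ge> 2"
    and eq: "frac_jacobian Q 1 C E * ([:f:] * [:0, 1:]) = homogenize (\<lambda>c. [:[:c:]:]) f Q 1 * C * E"
    and nz': "homogenize (\<lambda>c. [:[:c:]:]) f Q 1 \<noteq> 0"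
  defines "m \<equiv> of_int (int (degree C) - int (degree E))"
  obtains a b where "Q = [:[:b, a:]:]" "a \<noteq> 0" "pcompose f [:b, a:] = smult (a * m) f"
    "euler C * E - C * euler E = smult [:m:] (C * E)"
proof -
  let ?F = "pcompose (map_poly (\<lambda>c. [:c:]) f) Q" and ?T = "euler C * E - C * euler E"
  have f: "f \<noteq> 0"
    using deg by auto
  have degF: "degree ?F = degree f * degree Q"
    by (simp add: degree_pcompose degree_map_poly)
  have jac: "frac_jacobian Q 1 C E = map_poly pderiv Q * (pderiv C * E - C * pderiv E) -
      pderiv Q * (map_poly pderiv C * E - C * map_poly pderiv E)"
    by (simp add: frac_jacobian_def)
  \<comment> \<open>The factor y of the bracket is absorbed by turning y-derivatives into Euler
    operators.\<close>
  have eq': "(map_poly pderiv Q * ?T - euler Q * (map_poly pderiv C * E - C * map_poly pderiv E)) * [:f:] = ?F * C * E"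
    unfolding eq[unfolded homogenize_const_1, symmetric] jac euler_def by (simp only: algebra_simps)
  have "degree Q = 0"
  proof (rule ccontr)
    assume n: "degree Q \<noteq> 0"
    have "degree (map_poly pderiv Q * ?T) \<le> degree Q + (degree C + degree E)"
      by (rule order_trans[OF degree_mult_le add_mono[OF degree_map_pderiv_le degree_euler_wronskian_le]])
    moreover have "degree (map_poly pderiv C * E - C * map_poly pderiv E) \<le> degree C + degree E"
      by (intro degree_diff_le order_trans[OF degree_mult_le] add_mono degree_map_pderiv_le order_refl)
    then have "degree (euler Q * (map_poly pderiv C * E - C * map_poly pderiv E)) \<le> degree Q + (degree C + degree E)"
      by (rule order_trans[OF degree_mult_le add_mono[OF degree_euler_le]])
    ultimately have "degree (map_poly pderiv Q * ?T - euler Q * (map_poly pderiv C * E - C * map_poly pderiv E))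
        \<le> degree Q + (degree C + degree E)"
      by (rule degree_diff_le)
    then have "degree (?F * C * E) \<le> degree Q + (degree C + degree E)"
      unfolding eq'[symmetric] by (intro order_trans[OF degree_mult_le]) simp
    moreover have "degree (?F * C * E) = degree f * degree Q + degree C + degree E"
      using nz nz' by (simp add: degree_mult_eq homogenize_const_1 degF)
    moreover have "2 * degree Q \<le> degree f * degree Q"
      using deg by simp
    ultimately show False
      using n by linarith
  qed
  then obtain q where q: "Q = [:q:]"
    by (elim degree_eq_zeroE)
  have F: "?F = [:pcompose f q:]"
    by (simp add: q pcompose_const_const)
  have "euler Q = 0"
    by (simp add: q euler_def)
  then have eq2: "smult (pderiv q * f) ?T = smult (pcompose f q) (C * E)"
    using eq' unfolding F by (simp add: q map_poly_pCons mult.commute)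
  have lead: "pderiv q * f * poly.coeff ?T (degree C + degree E) = pcompose f q * (lead_coeff C * lead_coeff E)"
    using arg_cong[OF eq2, of "\<lambda>p. poly.coeff p (degree C + degree E)"]
    unfolding coeff_smult coeff_mult_degree_sum .
  have m: "[:m:] = of_int (int (degree C) - int (degree E))"
    by (simp only: m_def of_int_poly)
  have "(pderiv q * f * [:m:]) * (lead_coeff C * lead_coeff E) = pcompose f q * (lead_coeff C * lead_coeff E)"
    using lead unfolding coeff_euler_wronskian m by (simp only: mult.assoc)
  then have eq3: "pderiv q * f * [:m:] = pcompose f q"
    using nz by (simp only: mult_cancel_right) simp
  have "pcompose f q \<noteq> 0"
    using nz' by (simp add: homogenize_const_1 F)
  then have nz3: "pderiv q \<noteq> 0" "m \<noteq> 0"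
    using eq3 by auto
  have "degree f * degree q = degree q - 1 + degree f"
    using arg_cong[OF eq3, of degree] nz3 f by (simp add: degree_mult_eq degree_pderiv degree_pcompose)
  moreover obtain k where k: "degree q = Suc k"
    using nz3 by (cases "degree q") (simp_all add: pderiv_eq_0_iff)
  moreover obtain j where "degree f = Suc (Suc j)"
    using deg by (metis add_2_eq_Suc le_Suc_ex)
  \<comment> \<open>With \<open>degree f\<close> = j + 2 and \<open>degree q\<close> = k + 1, the
    degree equation reduces to (j + 1) k = 0.\<close>
  ultimately have "Suc j * k = 0"
    by simp
  then have "degree q = 1"
    using k by simp
  then obtain a b where ab: "q = [:b, a:]" "a \<noteq> 0"
  proof -
    obtain b r where q': "q = pCons b r"
      by (cases q)
    then have "degree r = 0"
      using \<open>degree q = 1\<close> by (simp split: if_splits)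
    then obtain a where "r = [:a:]"
      by (elim degree_eq_zeroE)
    then show ?thesis
      using that[of b a] q' \<open>degree q = 1\<close> by (auto split: if_splits)
  qed
  have comp: "pcompose f [:b, a:] = smult (a * m) f"
    using eq3 by (simp add: ab pderiv_pCons mult.commute[of m])
  have T: "?T = smult [:m:] (C * E)"
  proof -
    have "smult (pderiv q * f) ?T = smult (pderiv q * f) (smult [:m:] (C * E))"
      unfolding eq2 eq3[symmetric] by (simp only: smult_smult)
    then show ?thesis
      by (rule smult_cancel[rotated]) (use nz3 f in simp)
  qed
  have "Q = [:[:b, a:]:]"
    by (simp only: q ab)
  then show ?thesis
    using ab(2) comp T by (rule that)
qed

subsection \<open>Descent and the multiplier\<close>

lemma to_ac_hom: "coeff_hom to_ac"
  by standard simp_all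

lemma (in coeff_hom) hom_homogenize:
  "h (homogenize g f A B) = homogenize (\<lambda>c. h (g c)) f (h A) (h B)"
  by (simp add: homogenize_def hom_sum hom_mult hom_power)

lemma homogenize_map_poly:
  assumes "coeff_hom g" "inj g"
  shows "homogenize h (map_poly g f) A B = homogenize (\<lambda>c. h (g c)) f A B"
proof -
  interpret coeff_hom g by fact
  have "degree (map_poly g f) = degree f"
    using assms hom_0 by (intro degree_map_poly) (metis injD)
  then show ?thesis
    by (simp add: homogenize_def coeff_map_poly_hom)
qed

text \<open>
  Unique factorization is only available over coefficient fields with a gcd structure, so the absence
  of poles is established over the algebraic closure and the result is brought back to \<open>k\<close>.
\<close>

lemma affine_multiple_descent:
  fixes A B :: "'k::field poly poly"
  assumes "B \<noteq> 0" and eq: "map_poly (map_poly to_ac) A = [:[:b', a':]:] * map_poly (map_poly to_ac) B"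
  obtains a b where "A = [:[:b, a:]:] * B"
proof -
  interpret ac: coeff_hom "to_ac :: 'k \<Rightarrow> _" by (rule to_ac_hom)
  interpret acx: coeff_hom "map_poly to_ac :: 'k poly \<Rightarrow> _" by (rule ac.map_poly_hom)
  interpret acxy: coeff_hom "map_poly (map_poly to_ac) :: 'k poly poly \<Rightarrow> _" by (rule acx.map_poly_hom)
  have inj: "inj (map_poly (map_poly to_ac) :: 'k poly poly \<Rightarrow> _)"
    by (intro acx.inj_map_poly ac.inj_map_poly inj_to_ac)
  \<comment> \<open>The affine factor is determined by a single y-coefficient, and within it by the
    x-coefficients of index n + 1 and n. Solving these two equations expresses a' and b' by elements
    of the base field.\<close>
  define \<beta> where "\<beta> = lead_coeff B"
  define \<alpha> where "\<alpha> = poly.coeff A (degree B)"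
  define n where "n = degree \<beta>"
  have lc: "lead_coeff \<beta> \<noteq> 0"
    using assms by (simp add: \<beta>_def)
  have map_\<alpha>: "map_poly to_ac \<alpha> = [:b', a':] * map_poly to_ac \<beta>"
    using arg_cong[OF eq, of "\<lambda>P. poly.coeff P (degree B)"]
    by (simp add: acx.coeff_map_poly_hom \<alpha>_def \<beta>_def)
  have co: "to_ac (poly.coeff \<alpha> i) = b' * to_ac (poly.coeff \<beta> i) + a' * to_ac (poly.coeff (pCons 0 \<beta>) i)" for i
    unfolding ac.coeff_map_poly_hom[symmetric] map_\<alpha>
    by (cases i) (simp_all add: ac.coeff_map_poly_hom)
  have a': "a' = to_ac (poly.coeff \<alpha> (Suc n) / lead_coeff \<beta>)"
    using co[of "Suc n"] lc by (simp add: n_def coeff_eq_0)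
  then obtain a where a: "a' = to_ac a" by blast
  have "b' = to_ac ((poly.coeff \<alpha> n - a * poly.coeff (pCons 0 \<beta>) n) / lead_coeff \<beta>)"
    using co[of n] lc by (simp add: n_def a field_simps)
  then obtain b where b: "b' = to_ac b" by blast
  have "map_poly (map_poly to_ac) A = map_poly (map_poly to_ac) ([:[:b, a:]:] * B)"
    unfolding eq acxy.hom_mult by (simp add: a b map_poly_pCons)
  then show ?thesis
    using inj that by (metis injD)
qed

text \<open>The coefficientwise embedding into the algebraic closure commutes with all operations in
  the equation. There \<open>denominator_dvd_numerator\<close> makes A/B a polynomial,
  \<open>polynomial_image_affine\<close> makes it affine, and \<open>affine_multiple_descent\<close>
  returns to the base field.\<close>

lemma numerator_affine_multiple:
  fixes A B C E :: "'k::field_char_0 poly poly"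
  assumes nz: "B \<noteq> 0" "C \<noteq> 0" "E \<noteq> 0" and deg: "degree f \<ge> 3"
    and eq: "frac_jacobian A B C E * ([:f:] * [:0, 1:]) * B ^ (degree f - 2) = homogenize (\<lambda>c. [:[:c:]:]) f A B * C * E"
    and nz': "homogenize (\<lambda>c. [:[:c:]:]) f A B \<noteq> 0"
  obtains a b where "A = [:[:b, a:]:] * B"
proof -
  interpret ac: coeff_hom "to_ac :: 'k \<Rightarrow> _" by (rule to_ac_hom)
  interpret acx: coeff_hom "map_poly to_ac :: 'k poly \<Rightarrow> _" by (rule ac.map_poly_hom)
  interpret acxy: coeff_hom "map_poly (map_poly to_ac) :: 'k poly poly \<Rightarrow> _" by (rule acx.map_poly_hom)
  let ?H = "map_poly (map_poly to_ac) :: 'k poly poly \<Rightarrow> 'k alg_closure poly poly" and ?f = "map_poly to_ac f"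
  have inj: "inj ?H"
    by (intro acx.inj_map_poly ac.inj_map_poly inj_to_ac)
  have H0: "?H P = 0 \<longleftrightarrow> P = 0" for P
    using inj acxy.hom_0 by (metis injD)
  have Hdx: "map_poly pderiv (?H P) = ?H (map_poly pderiv P)" for P
    by (intro poly_eqI) (simp add: acx.coeff_map_poly_hom coeff_map_poly ac.map_poly_hom_pderiv)
  have deg': "degree ?f = degree f"
    by (intro degree_map_poly) simp
  have jac: "?H (frac_jacobian A B C E) = frac_jacobian (?H A) (?H B) (?H C) (?H E)"
    by (simp add: frac_jacobian_def acxy.hom_mult acxy.hom_diff Hdx acx.map_poly_hom_pderiv)
  have w: "?H ([:f:] * [:0, 1:]) = [:?f:] * [:0, 1:]"
    unfolding acxy.hom_mult by (simp add: map_poly_pCons)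
  have hom: "?H (homogenize (\<lambda>c. [:[:c:]:]) f A B) = homogenize (\<lambda>c. [:[:c:]:]) ?f (?H A) (?H B)"
    unfolding acxy.hom_homogenize homogenize_map_poly[OF to_ac_hom inj_to_ac]
    by (simp add: map_poly_pCons)
  have eq': "frac_jacobian (?H A) (?H B) (?H C) (?H E) * ([:?f:] * [:0, 1:]) * ?H B ^ (degree ?f - 2) =
      homogenize (\<lambda>c. [:[:c:]:]) ?f (?H A) (?H B) * ?H C * ?H E"
    using arg_cong[OF eq, of ?H] unfolding acxy.hom_mult[of _ "B ^ _"] acxy.hom_mult[of _ "_ * [:0, 1:]"] w
    by (simp only: acxy.hom_mult[of _ C] acxy.hom_mult[of _ E] acxy.hom_power jac hom deg')
  have "?H B dvd ?H A"
    using denominator_dvd_numerator[OF _ _ _ _ eq'] nz deg H0 deg' by simp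
  then obtain Q where Q: "?H A = Q * ?H B"
    by (metis dvdE mult.commute)
  have red: "frac_jacobian Q 1 (?H C) (?H E) * ([:?f:] * [:0, 1:]) = homogenize (\<lambda>c. [:[:c:]:]) ?f Q 1 * ?H C * ?H E"
    using homogenize_reduce[OF _ _ eq'[unfolded Q]] nz deg H0 deg' by simp
  have "homogenize (\<lambda>c. [:[:c:]:]) ?f (?H B * Q) (?H B * 1) \<noteq> 0"
    using nz' unfolding H0[symmetric] hom Q by (simp add: mult.commute)
  then have "homogenize (\<lambda>c. [:[:c:]:]) ?f Q 1 \<noteq> 0"
    unfolding homogenize_scale by simp
  then obtain a' b' where "Q = [:[:b', a':]:]"
    using polynomial_image_affine[OF _ _ _ red] nz deg H0 deg' by (metis One_nat_def Suc_1 Suc_leD numeral_3_eq_3)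
  then show ?thesis
    using affine_multiple_descent[OF nz(1)] Q that by metis
qed

section \<open>Affine substitutions that multiply a polynomial by a constant\<close>

lemma coeff_pcompose_linear: "poly.coeff (pcompose p [:0, a:]) i = a ^ i * poly.coeff (p :: 'a::idom poly) i"
  by (induction p arbitrary: i) (auto simp: pcompose_pCons coeff_pCons split: nat.splits)

lemma pcompose_power: "pcompose (p ^ n) q = pcompose p q ^ n"
  by (induction n) (simp_all add: pcompose_1 pcompose_mult)

text \<open>If a = 1, leading coefficients give m = 1. Otherwise moving the fixed point r of x -> a
  x + b to 0 turns f into g with g(a x) = a m g(x), so a^i = a m whenever g has a term of degree i.
  Since f is not a multiple of a power of x - r, two such exponents exist. Their difference k
  satisfies a^k = 1, and m = a^(degree f - 1) is an integer with m^k = 1.\<close>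

lemma affine_multiplier_unit:
  fixes f :: "'a::field_char_0 poly"
  assumes deg: "degree f \<ge> 1" and a: "a \<noteq> 0" and eq: "pcompose f [:b, a:] = smult (a * of_int m) f"
    and not_power: "\<And>c r. f \<noteq> smult c ([:- r, 1:] ^ degree f)"
  shows "\<bar>m\<bar> = 1"
proof (cases "a = 1")
  case True
  have "poly.coeff (pcompose f [:b, a:]) (degree f) = lead_coeff f"
    using lead_coeff_comp[of "[:b, a:]" f] True by (simp add: degree_pcompose)
  then have "of_int m * lead_coeff f = 1 * lead_coeff f"
    unfolding eq using True by simp
  moreover have "lead_coeff f \<noteq> 0"
    using deg by auto
  ultimately have "of_int m = (1 :: 'a)"
    by (metis mult_right_cancel)
  then show ?thesis
    by simp
next
  case False
  define r where "r = b / (1 - a)"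
  define g where "g = pcompose f [:r, 1:]"
  have r: "b + a * r = r"
    using False by (simp add: r_def field_simps)
  have "pcompose g [:0, a:] = pcompose (pcompose f [:b, a:]) [:r, 1:]"
    by (simp add: g_def pcompose_pCons r flip: pcompose_assoc) 
  then have g_eq: "pcompose g [:0, a:] = smult (a * of_int m) g"
    by (simp add: eq g_def pcompose_smult)
  have f: "f = pcompose g [:- r, 1:]"
    by (simp add: g_def pcompose_pCons flip: pcompose_assoc)
  have deg_g: "degree g = degree f"
    by (simp add: g_def degree_pcompose)
  have pow: "a ^ i = a * of_int m" if "poly.coeff g i \<noteq> 0" for i
    using arg_cong[OF g_eq, of "\<lambda>p. poly.coeff p i"] that by (simp add: coeff_pcompose_linear)
  have "\<exists>j < degree f. poly.coeff g j \<noteq> 0"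
  proof (rule ccontr)
    assume none: "\<not> (\<exists>j < degree f. poly.coeff g j \<noteq> 0)"
    have "g = Polynomial.monom (lead_coeff g) (degree f)"
    proof (rule poly_eqI)
      fix i
      show "poly.coeff g i = poly.coeff (Polynomial.monom (lead_coeff g) (degree f)) i"
        using none deg_g by (cases i "degree f" rule: linorder_cases) (auto simp: coeff_eq_0)
    qed
    then have g: "g = smult (lead_coeff g) ([:0, 1:] ^ degree f)"
      by (simp add: monom_altdef)
    have "f = smult (lead_coeff g) ([:- r, 1:] ^ degree f)"
      by (subst f, subst g) (simp add: pcompose_smult pcompose_power pcompose_pCons)
    then show False
      using not_power by blast
  qed
  then obtain j where j: "j < degree f" "poly.coeff g j \<noteq> 0" by blast
  define k where "k = degree f - j"
  have "a ^ degree f = a * of_int m"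
    using deg deg_g by (intro pow) (metis degree_0 leading_coeff_0_iff not_one_le_zero)
  moreover have "a ^ degree f = a ^ j * a ^ k"
    using j by (simp add: k_def flip: power_add)
  ultimately have "a ^ k = 1"
    using pow[OF j(2)] a by (metis mult_cancel_left2 power_not_zero)
  have "a ^ (degree f - 1) = of_int m"
    using \<open>a ^ degree f = a * of_int m\<close> deg a by (cases "degree f") simp_all
  then have "of_int (m ^ k) = (1 :: 'a)"
    using \<open>a ^ k = 1\<close> by (metis mult.commute of_int_power power_mult power_one)
  then have "m ^ k = 1"
    by (metis of_int_eq_1_iff)
  then have "\<bar>m\<bar> ^ k = 1 ^ k"
    by (simp flip: power_abs)
  then show ?thesis
    by (rule power_eq_imp_eq_base) (use j in \<open>simp_all add: k_def\<close>)
qed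

text \<open>Equal logarithmic Euler derivatives force equal degrees, by
  \<open>coeff_euler_wronskian\<close> and characteristic zero. The combination W that cancels the
  leading terms satisfies the same relation with V, so if nonzero it would have the degree of V,
  where its coefficient is 0.\<close>

lemma euler_proportional:
  fixes U V :: "'a::{idom,ring_char_0} poly"
  assumes nz: "U \<noteq> 0" "V \<noteq> 0" and eq: "euler U * V = U * euler V"
  shows "smult (lead_coeff V) U = smult (lead_coeff U) V"
proof -
  have same_degree: "degree U = degree V" if "U \<noteq> 0" "euler U * V - U * euler V = 0" for U
    using coeff_euler_wronskian[of U V] that nz by simp
  define W where "W = smult (lead_coeff V) U - smult (lead_coeff U) V"
  have "euler W = smult (lead_coeff V) (euler U) - smult (lead_coeff U) (euler V)"
    by (simp add: W_def euler_def pderiv_diff pderiv_smult algebra_simps)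
  then have "euler W * V - W * euler V = smult (lead_coeff V) (euler U * V - U * euler V)"
    by (simp only:) (simp add: W_def algebra_simps smult_diff_right)
  then have W: "euler W * V - W * euler V = 0"
    by (simp add: eq)
  have "poly.coeff W (degree V) = 0"
    using same_degree[of U] nz eq by (simp add: W_def)
  then have "W = 0"
    using same_degree[OF _ W] by (metis leading_coeff_0_iff)
  then show ?thesis
    by (simp add: W_def)
qed

subsection \<open>Surjectivity\<close>

lemma rf_poly_x_nonzero: "u \<noteq> 0 \<Longrightarrow> rf_poly_x u \<noteq> 0"
  by (simp add: rf_poly_x_def)

lemma to_fract_hom: "coeff_hom to_fract"
  by standard simp_all

lemma rf_poly_x_hom: "coeff_hom rf_poly_x"
  by standard (simp_all add: rf_poly_x_def flip: to_fract_add to_fract_mult one_pCons)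

lemma to_fract_smult: "to_fract (smult u P) = rf_poly_x u * to_fract P"
  by (simp add: rf_poly_x_def flip: to_fract_mult)

lemma euler_y_mult: "euler ([:0, 1:] * P) = [:0, 1:] * P + [:0, 1:] * euler P"
  by (simp add: euler_def pderiv_mult pderiv_pCons algebra_simps)

text \<open>Dividing C/E by y, or multiplying by y when the eigenvalue is -1, shifts the eigenvalue
  to 0; then \<open>euler_proportional\<close> leaves a quotient of polynomials in x.\<close>

lemma euler_eigen_fraction:
  fixes C E :: "'k::field_char_0 poly poly"
  assumes nz: "C \<noteq> 0" "E \<noteq> 0" and i: "\<bar>i\<bar> = (1 :: int)"
    and eq: "euler C * E - C * euler E = smult [:of_int i:] (C * E)"
  obtains u v where "u \<noteq> 0" "v \<noteq> 0"
    "to_fract C / to_fract E = rf_poly_x u / rf_poly_x v * rf_Y \<or>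
     to_fract C / to_fract E = rf_poly_x u / rf_poly_x v / rf_Y"
proof (cases "i = 1")
  case True
  define V where "V = [:0, 1:] * E"
  have V: "V \<noteq> 0" and toV: "to_fract V = rf_Y * to_fract E"
    unfolding V_def using nz by (simp_all only: to_fract_mult rf_Y_def mult_eq_0_iff) simp
  have "euler C * V - C * euler V = [:0, 1:] * (euler C * E - C * euler E - C * E)"
    unfolding V_def euler_y_mult by (simp only: algebra_simps)
  then have "euler C * V = C * euler V"
    unfolding eq using True by (simp flip: one_pCons)
  then have "smult (lead_coeff V) C = smult (lead_coeff C) V"
    by (rule euler_proportional[OF nz(1) V])
  then have "rf_poly_x (lead_coeff V) * to_fract C = rf_poly_x (lead_coeff C) * to_fract V"
    by (metis to_fract_smult)
  then show ?thesis
    using that[of "lead_coeff C" "lead_coeff V"] nz V by (simp add: rf_poly_x_nonzero field_simps toV)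
next
  case False
  define U where "U = [:0, 1:] * C"
  have U: "U \<noteq> 0" and toU: "to_fract U = rf_Y * to_fract C"
    unfolding U_def using nz by (simp_all only: to_fract_mult rf_Y_def mult_eq_0_iff) simp
  have "euler U * E - U * euler E = [:0, 1:] * (euler C * E - C * euler E + C * E)"
    unfolding U_def euler_y_mult by (simp only: algebra_simps)
  moreover have "i = -1"
    using False i by simp
  moreover have "[:- 1:] = (- 1 :: 'k poly)"
    by (simp add: one_pCons)
  ultimately have "euler U * E = U * euler E"
    unfolding eq by simp
  then have "smult (lead_coeff E) U = smult (lead_coeff U) E"
    by (rule euler_proportional[OF U nz(2)])
  then have "rf_poly_x (lead_coeff E) * to_fract U = rf_poly_x (lead_coeff U) * to_fract E"
    by (metis to_fract_smult)
  then show ?thesis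
    using that[of "lead_coeff U" "lead_coeff E"] nz U by (simp add: rf_poly_x_nonzero field_simps toU)
qed

text \<open>Over the algebraic closure the left side vanishes at 0 and at z, while a nonzero
  multiple of a power of x - r can vanish only at r.\<close>

lemma not_power_if_two_roots:
  fixes p :: "'k::field poly"
  assumes "p \<noteq> 0" and z: "z \<noteq> 0" "poly (map_poly to_ac p) z = 0"
  shows "pCons 0 p \<noteq> smult c ([:- r, 1:] ^ n)"
proof
  assume eq: "pCons 0 p = smult c ([:- r, 1:] ^ n)"
  then have c: "c \<noteq> 0"
    using assms by auto
  interpret ac: coeff_hom "to_ac :: 'k \<Rightarrow> _" by (rule to_ac_hom)
  interpret ev: coeff_hom "\<lambda>p. poly (map_poly to_ac p) z" by (rule ac.eval_hom)
  have "poly (map_poly to_ac (pCons 0 p)) z = to_ac c * (z - to_ac r) ^ n"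
    unfolding eq by (simp add: ac.map_poly_hom_smult ev.hom_power map_poly_pCons)
  then have "z = to_ac r"
    using c z by (simp add: map_poly_pCons)
  moreover have "c * (- r) ^ n = 0"
    using arg_cong[OF eq, of "\<lambda>p. poly p 0"] by simp
  ultimately show False
    using c z by simp
qed

text \<open>The range is a subfield containing the constants. It contains \<open>rf_X\<close> by
  inverting the affine map, hence every rational function of x, and dividing out the x-factor gives
  \<open>rf_Y\<close>.\<close>

lemma bij_if_generators_in_range:
  assumes h: "coeff_hom h" "\<And>c. h (rf_const c) = rf_const c"
    and X: "h x = rf_const a * rf_X + rf_const b" "a \<noteq> 0"
    and uv: "u \<noteq> 0" "v \<noteq> 0"
    and Y: "h y = rf_poly_x u / rf_poly_x v * rf_Y \<or> h y = rf_poly_x u / rf_poly_x v / rf_Y"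
  shows "bij h"
proof -
  interpret h: coeff_hom h by fact
  have inv: "h q * h (1 / q) = 1" if "q \<noteq> 0" for q
    using that by (simp add: h.hom_1 flip: h.hom_mult)
  have div: "h (q / r) = h q / h r" for q r
  proof (cases "r = 0")
    case False
    then have "h q = h (q / r) * h r"
      by (simp flip: h.hom_mult)
    moreover have "h r \<noteq> 0"
      using inv[OF False] by auto
    ultimately show ?thesis
      by simp
  qed (simp add: h.hom_0)
  have "inj h"
  proof (rule injI)
    fix q r assume "h q = h r"
    then have "h (q - r) = 0"
      by (simp add: h.hom_diff)
    then show "q = r"
      using inv[of "q - r"] by auto
  qed
  define x' where "x' = (x - rf_const b) / rf_const a"
  have x': "h x' = rf_X"
    using X by (simp add: x'_def div h.hom_diff h)
  \<comment> \<open>Evaluating u/v at the preimage of \<open>rf_X\<close> gives a preimage of the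
    x-factor of \<open>h y\<close>.\<close>
  define g where "g = poly (map_poly rf_const u) x' / poly (map_poly rf_const v) x'"
  have g: "h g = rf_poly_x u / rf_poly_x v"
    by (simp add: g_def div hom_rf_eval_x[OF h] x' rf_poly_x_eq)
  have "h (y / g) = rf_Y \<or> h (g / y) = rf_Y"
    using Y uv by (auto simp: div g rf_poly_x_nonzero)
  then obtain y' where y': "h y' = rf_Y"
    by blast
  have "q \<in> range h" for q
  proof -
    obtain P Q where "q = to_fract P / to_fract Q"
      by (metis Fract_cases Fract_conv_to_fract)
    then have "q = h (rf_eval x' y' P / rf_eval x' y' Q)"
      by (simp add: div hom_rf_eval[OF h] x' y' to_fract_eq_eval)
    then show ?thesis by blast
  qed
  then show ?thesis
    using \<open>inj h\<close> by (auto simp: bij_def)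
qed

section \<open>Clearing denominators in the bracket relation\<close>

lemma jacobian_fraction:
  fixes A B C E :: "'k::field poly poly"
  assumes "B \<noteq> 0" "E \<noteq> 0"
  defines "q \<equiv> to_fract A / to_fract B" and "r \<equiv> to_fract C / to_fract E"
  shows "(rf_dx q * rf_dy r - rf_dy q * rf_dx r) * ((to_fract B)\<^sup>2 * (to_fract E)\<^sup>2) = to_fract (frac_jacobian A B C E)"
  using assms by (simp add: dx.divide dy.divide rf_dx_to_fract rf_dy_to_fract frac_jacobian_def field_simps)

lemma poisson_endomorphism_bij:
  fixes p :: "'k::field_char_0 poly"
  assumes deg: "degree p \<ge> 2" and z: "z \<noteq> 0" "poly (map_poly to_ac p) z = 0"
    and \<phi>: "poisson_endomorphism (rf_poly_x p * rf_X * rf_Y) \<phi>"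
  shows "bij \<phi>"
proof -
  have const: "\<And>c. \<phi> (rf_const c) = rf_const c"
    and bracket: "\<And>g h. \<phi> (poisson_bracket (rf_poly_x p * rf_X * rf_Y) g h) =
      poisson_bracket (rf_poly_x p * rf_X * rf_Y) (\<phi> g) (\<phi> h)"
    using \<phi> by (auto simp: poisson_endomorphism_def algebra_endomorphism_def)
  have hom: "coeff_hom \<phi>"
    using \<phi> const[of 1] by unfold_locales (auto simp: poisson_endomorphism_def algebra_endomorphism_def rf_const.hom_1)
  interpret phi: coeff_hom \<phi> by (rule hom)
  have phi_nz: "\<phi> q \<noteq> 0" if "q \<noteq> 0" for q
    using phi.hom_mult[of q "1 / q"] that phi.hom_1 by auto
  \<comment> \<open>Absorbing the factor x raises the degree to at least 3, the bound that excludes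
    poles.\<close>
  define f where "f = pCons 0 p"
  have "p \<noteq> 0" and degf: "degree f \<ge> 3"
    using deg by (auto simp: f_def)
  have f0: "rf_poly_x p * rf_X = rf_poly_x f"
    by (simp add: f_def rf_poly_x_mult_X)
  obtain A B where AB: "\<phi> rf_X = to_fract A / to_fract B" "B \<noteq> 0"
    by (metis Fract_cases Fract_conv_to_fract)
  obtain C E where CE: "\<phi> rf_Y = to_fract C / to_fract E" "E \<noteq> 0"
    by (metis Fract_cases Fract_conv_to_fract)
  have C: "C \<noteq> 0"
    using CE phi_nz[of rf_Y] by auto
  let ?F = "homogenize (\<lambda>c. [:[:c:]:]) f A B"
  have "to_fract ?F = homogenize rf_const f (to_fract B * \<phi> rf_X) (to_fract B * 1)"
    using AB unfolding coeff_hom.hom_homogenize[OF to_fract_hom] by (simp add: rf_const_def[abs_def])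
  also have "\<dots> = to_fract B ^ degree f * \<phi> (rf_poly_x f)"
    unfolding homogenize_scale rf_const.homogenize_1 rf_poly_x_eq hom_rf_eval_x[OF hom const] ..
  finally have F: "to_fract ?F = to_fract B ^ degree f * \<phi> (rf_poly_x f)" .
  have F0: "?F \<noteq> 0"
    using F AB(2) phi_nz[OF rf_poly_x_nonzero, of f] degf by (metis degree_0 mult_eq_0_iff not_numeral_le_zero power_not_zero to_fract_eq_0_iff)
  have w: "to_fract ([:f:] * [:0, 1:]) = rf_poly_x f * rf_Y"
    by (simp only: to_fract_mult rf_poly_x_def rf_Y_def)
  have J: "(rf_dx (\<phi> rf_X) * rf_dy (\<phi> rf_Y) - rf_dy (\<phi> rf_X) * rf_dx (\<phi> rf_Y)) * (rf_poly_x f * rf_Y) = \<phi> (rf_poly_x f) * \<phi> rf_Y"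
    using bracket[of rf_X rf_Y] unfolding poisson_bracket_X_Y f0 phi.hom_mult by (simp add: poisson_bracket_def)
  have "2 + (degree f - 2) = degree f"
    using degf by simp
  then have Bd: "to_fract B ^ degree f = (to_fract B)\<^sup>2 * to_fract B ^ (degree f - 2)"
    by (metis power_add)
  \<comment> \<open>The relation \<open>J\<close>, multiplied by B^(degree f) E^2, becomes a
    polynomial identity; B^2 E^2 clears the Jacobian and the other powers of B complete the
    homogenization of f.\<close>
  have "to_fract (frac_jacobian A B C E * ([:f:] * [:0, 1:]) * B ^ (degree f - 2)) =
      (rf_dx (\<phi> rf_X) * rf_dy (\<phi> rf_Y) - rf_dy (\<phi> rf_X) * rf_dx (\<phi> rf_Y)) * ((to_fract B)\<^sup>2 * (to_fract E)\<^sup>2)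
        * (rf_poly_x f * rf_Y) * to_fract B ^ (degree f - 2)"
    unfolding AB(1) CE(1) jacobian_fraction[OF AB(2) CE(2)] to_fract_mult[of _ "B ^ _"] to_fract_mult[of _ "_ * [:0, 1:]"] w
    by (simp only: coeff_hom.hom_power[OF to_fract_hom])
  also have "\<dots> = (to_fract B)\<^sup>2 * to_fract B ^ (degree f - 2) * \<phi> (rf_poly_x f) * (\<phi> rf_Y * (to_fract E)\<^sup>2)"
    using arg_cong[OF J, of "\<lambda>t. t * ((to_fract B)\<^sup>2 * (to_fract E)\<^sup>2 * to_fract B ^ (degree f - 2))"]
    by (simp only: ac_simps)
  also have "\<dots> = to_fract ?F * (\<phi> rf_Y * (to_fract E)\<^sup>2)"
    unfolding F Bd ..
  also have "\<dots> = to_fract (?F * C * E)"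
    using CE by (simp add: power2_eq_square)
  finally have eq: "frac_jacobian A B C E * ([:f:] * [:0, 1:]) * B ^ (degree f - 2) = ?F * C * E"
    unfolding to_fract_eq_iff .
  obtain a' b' where A: "A = [:[:b', a':]:] * B"
    by (rule numerator_affine_multiple[OF AB(2) C CE(2) degf eq F0])
  have red: "frac_jacobian [:[:b', a':]:] 1 C E * ([:f:] * [:0, 1:]) = homogenize (\<lambda>c. [:[:c:]:]) f [:[:b', a':]:] 1 * C * E"
    using homogenize_reduce[OF AB(2) _ eq[unfolded A]] degf by simp
  have "homogenize (\<lambda>c. [:[:c:]:]) f (B * [:[:b', a':]:]) (B * 1) \<noteq> 0"
    using F0 unfolding A mult.commute[of B] mult_1_right .
  then have red0: "homogenize (\<lambda>c. [:[:c:]:]) f [:[:b', a':]:] 1 \<noteq> 0"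
    by (metis homogenize_scale mult_zero_right)
  define i where "i = int (degree C) - int (degree E)"
  obtain a b where ab: "[:[:b', a':]:] = [:[:b, a:]:]" "a \<noteq> 0" "pcompose f [:b, a:] = smult (a * of_int i) f"
    "euler C * E - C * euler E = smult [:of_int i:] (C * E)"
    using polynomial_image_affine[OF C CE(2) _ red red0] degf unfolding i_def
    by (metis One_nat_def Suc_1 Suc_leD numeral_3_eq_3)
  have "\<bar>i\<bar> = 1"
    using affine_multiplier_unit[OF _ ab(2,3)] degf not_power_if_two_roots[OF \<open>p \<noteq> 0\<close> z]
    unfolding f_def by simp
  then obtain u v where uv: "u \<noteq> 0" "v \<noteq> 0"
    "to_fract C / to_fract E = rf_poly_x u / rf_poly_x v * rf_Y \<or>
     to_fract C / to_fract E = rf_poly_x u / rf_poly_x v / rf_Y"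
    using euler_eigen_fraction[OF C CE(2) _ ab(4)] by metis
  have "\<phi> rf_X = rf_poly_x [:b, a:]"
    using AB(2) unfolding AB(1) A ab(1) to_fract_mult by (simp add: rf_poly_x_def)
  then have "\<phi> rf_X = rf_const a * rf_X + rf_const b"
    unfolding rf_poly_x_eq by (simp add: rf_const.map_poly_hom_pCons rf_const.hom_0 mult.commute)
  then show ?thesis
    using ab(2) uv(1,2) uv(3)[folded CE(1)] by (rule bij_if_generators_in_range[OF hom const])
qed

text \<open>Three families remain: constants, linear polynomials with a nonzero root, and monomials
  of positive degree.\<close>

lemma not_dixmier_if_low_degree_or_no_root:
  fixes p :: "'k::field_char_0 poly"
  assumes "\<not> (degree p \<ge> 2 \<and> (\<exists>z :: 'k alg_closure. z \<noteq> 0 \<and> poly (map_poly to_ac p) z = 0))"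
  shows "\<not> dixmier_property (rf_poly_x p * rf_X * rf_Y)"
proof (cases "p = 0 \<or> degree p = 0")
  case True
  \<comment> \<open>The zero polynomial is included with c = 0, where the bracket is identically
    zero.\<close>
  then obtain c where "p = [:c:]"
    by (metis degree_0 degree_eq_zeroE)
  then have "rf_poly_x p = rf_const c"
    by (simp add: rf_poly_x_def rf_const_def)
  then show ?thesis
    by (simp add: not_dixmier_const)
next
  case False
  then have p: "p \<noteq> 0" "degree p \<noteq> 0" by simp_all
  show ?thesis
  proof (cases "\<exists>z :: 'k alg_closure. z \<noteq> 0 \<and> poly (map_poly to_ac p) z = 0")
    case True
    then obtain z :: "'k alg_closure" where z: "z \<noteq> 0" "poly (map_poly to_ac p) z = 0"
      by blast
    have "degree p = 1"
      using assms True p by auto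
    obtain b q where q: "p = pCons b q"
      by (cases p)
    then have "degree q = 0"
      using \<open>degree p = 1\<close> by (simp split: if_splits)
    then obtain c where "q = [:c:]"
      by (elim degree_eq_zeroE)
    then have c: "p = [:b, c:]" "c \<noteq> 0"
      using q p by auto
    have "b \<noteq> 0"
      using z c by (auto simp: map_poly_pCons)
    have "rf_poly_x p = rf_const c * (rf_X - rf_const (- b / c))"
    proof -
      have "rf_const c * rf_const (b / c) = rf_const b"
        using c by (simp flip: rf_const.hom_mult)
      then show ?thesis
        using c by (simp add: rf_poly_x_eq rf_const.map_poly_hom_pCons rf_const.hom_0 rf_const.hom_minus algebra_simps)
    qed
    then show ?thesis
      using not_dixmier_linear[of "- b / c" c] c \<open>b \<noteq> 0\<close> by simp
  next
    case False
    \<comment> \<open>Split off the full power of x. A root of the cofactor q in the closure would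
      be a nonzero root of p, so q is constant and p is a monomial.\<close>
    obtain q where q: "p = [:- 0, 1:] ^ order 0 p * q" "\<not> [:- 0, 1:] dvd q"
      using order_decomp[OF p(1), of 0] by blast
    interpret ac: coeff_hom "to_ac :: 'k \<Rightarrow> _" by (rule to_ac_hom)
    have "degree q = 0"
    proof (rule ccontr)
      assume "degree q \<noteq> 0"
      moreover have "degree (map_poly to_ac q) = degree q"
        by (intro degree_map_poly) simp
      ultimately obtain z where z: "poly (map_poly to_ac q) z = 0"
        using alg_closed_imp_poly_has_root[of "map_poly to_ac q"] by auto
      then have "poly (map_poly to_ac p) z = 0"
        by (subst q) (simp add: ac.map_poly_hom_mult)
      then have "z = 0"
        using False by blast
      then have "poly q 0 = 0"
        using z by (simp add: poly_0_coeff_0 ac.coeff_map_poly_hom)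
      then show False
        using q(2) by (simp add: dvd_iff_poly_eq_0)
    qed
    then obtain c where c: "q = [:c:]"
      by (elim degree_eq_zeroE)
    define n where "n = order 0 p"
    have pc: "p = [:0, 1:] ^ n * [:c:]"
      using q(1) unfolding c n_def by simp
    have "n \<noteq> 0"
      using p(2) pc by (cases n) simp_all
    have "rf_poly_x p = rf_X ^ n * rf_const c"
      unfolding pc coeff_hom.hom_mult[OF rf_poly_x_hom] coeff_hom.hom_power[OF rf_poly_x_hom]
      by (simp add: rf_poly_x_def rf_const_def rf_X_def)
    then show ?thesis
      using not_dixmier_monom[of n c] \<open>n \<noteq> 0\<close> by (simp add: ac_simps)
  qed
qed

theorem corollary5p3:
  fixes p :: "'k::field_char_0 poly"
  shows "dixmier_property (rf_poly_x p * rf_X * rf_Y) \<longleftrightarrow>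
    Polynomial.degree p \<ge> 2 \<and>
    (\<exists>z :: 'k alg_closure. z \<noteq> 0 \<and> poly (map_poly to_ac p) z = 0)"
  using poisson_endomorphism_bij not_dixmier_if_low_degree_or_no_root unfolding dixmier_property_def by blast

end
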